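(* For every common schema $\mathcal S$ there exist a SHACL schema $\mathcal S_1$ and a ShEx schema $\mathcal S_2$ that are both equivalent to $\mathcal S$, i.e. for every common graph $\mathcal G$: $\mathcal G\models\mathcal S$ iff $\mathcal G\models\mathcal S_1$, and $\mathcal G\models\mathcal S$ iff $\mathcal G\models\mathcal S_2$.
   Context: **Common graphs.** Fix pairwise disjoint countable sets $\mathcal N$ (nodes), $\mathcal V$ (values), $\mathcal P$ (predicates), $\mathcal K$ (keys). A common graph is a pair $\mathcal G=(E,\rho)$ where $E\subseteq\mathcal N\times\mathcal P\times\mathcal N$ is finite and $\rho:\mathcal N\times\mathcal K\rightharpoonup\mathcal V$ is a partial function with finite domain. $\mathcal G$ is identified with the finite set of triples $E\cup\{(u,k,w)\mid\rho(u,k)=w\}$, a subset of $\mathcal E=(\mathcal N\times\mathcal P\times\mathcal N)\cup(\mathcal N\times\mathcal K\times\mathcal V)$. $\mathsf{Nodes}(\mathcal G)$ is the set of elements of $\mathcal N$ occurring in $E$ or in the domain of $\rho$; $\mathsf{Values}(\mathcal G)$ is the range of $\rho$. A record is a finite-domain partial function $\mathcal K\rightharpoonup\mathcal V$, viewed as a set of pairs; $\mathcal R$ is the set of all records. For a node $v$, $\rho(v)$ is the record $\{(k,w)\mid\rho(v,k)=w\}$. **Value types.** $\mathcal T$ is an enumerable set of value types; each $\mathbb v\in\mathcal T$ has a set $[\![\mathbb v]\!]\subseteq\mathcal V$; every value belongs to some $[\![\mathbb v]\!]$; there is $\mathbb{any}\in\mathcal T$ with $[\![\mathbb{any}]\!]=\mathcal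 V$. **Schemas.** In each language a schema $\mathcal S$ is a set of pairs $(sel,\varphi)$ of a selector and a shape of that language (finite for common schemas and SHACL schemas). $\mathcal G\models\mathcal S$ means: for all $v\in\mathcal N\cup\mathcal V$ and $(sel,\varphi)\in\mathcal S$, $\mathcal G,v\models sel$ implies $\mathcal G,v\models\varphi$. **Common shapes.** Below $n\in\mathbb N$, $P\subseteq\mathcal P$ finite, $k,k'\in\mathcal K$, $c\in\mathcal V$, $p\in\mathcal P$, $\mathbb v\in\mathcal T$. Grammar: - closed content types: $\mathbb c::=\{\}\mid\{k:\mathbb v\}\mid\mathbb c\,\&\,\mathbb c\mid\mathbb c\,|\,\mathbb c$; - filters: $\pi_0::=[k=c]\mid\neg[k=c]\mid\mathbb c\,\&\,\top\mid\neg(\mathbb c\,\&\,\top)\mid\pi_0\cdot\pi_0$; - $\pi_1::=\pi_0\cdot p\cdot\pi_0\mid\pi_0\cdot p^-\cdot\pi_0\mid\pi_0\cdot k\mid k^-\cdot\pi_0$; - $\bar\pi::=\pi_0\mid p\mid\bar\pi^-\mid\bar\pi\cdot\bar\pi\mid\bar\pi\cup\bar\pi$; - $\pi::=\bar\pi\mid\bar\pi\cdot k\mid k^-\cdot\bar\pi\mid k^-\cdot\bar\pi\cdot k'$; - common shapes: $\varphi::=\exists\,\pi\mid\exists^{\le n}\pi_1\mid\exists^{\ge n}\pi_1\mid(\exists\,\mathbb c\wedge\nexists\,\neg P)\mid\varphi\wedge\varphi$. $\exists$ and $\nexists$ abbreviate $\exists^{\ge1}$ and $\exists^{\le0}$.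 As a path, $k$ alone abbreviates $\top\cdot k$ and $k^-$ alone abbreviates $k^-\cdot\top$ (equivalently with $\{\}\&\top$ in place of $\top$). Semantics of content types (subsets of $\mathcal R$): $[\![\top]\!]=\mathcal R$; $[\![\{\}]\!]=\{\emptyset\}$; $[\![\{k:\mathbb v\}]\!]=\{\{(k,w)\}\mid w\in[\![\mathbb v]\!]\}$; $[\![\mathbb c_1\&\mathbb c_2]\!]=\{r_1\cup r_2\mid r_1\in[\![\mathbb c_1]\!],r_2\in[\![\mathbb c_2]\!],\ r_1\cup r_2\in\mathcal R\}$; $[\![\mathbb c_1|\mathbb c_2]\!]=[\![\mathbb c_1]\!]\cup[\![\mathbb c_2]\!]$. Semantics of these path expressions on $\mathcal G=(E,\rho)$, as binary relations: $[k=c]$: $\{(u,u)\mid u\in\mathsf{Nodes}(\mathcal G),(k,c)\in\rho(u)\}$; $\neg[k=c]$: same with $(k,c)\notin\rho(u)$; a content type $\mathbb c$: $\{(u,u)\mid u\in\mathsf{Nodes}(\mathcal G),\rho(u)\in[\![\mathbb c]\!]\}$; $\neg\mathbb c$: same with $\rho(u)\notin[\![\mathbb c]\!]$; $k$: $\{(u,w)\mid\rho(u,k)=w\}$; $p$: $\{(u,v)\mid(u,p,v)\in E\}$; $\neg P$: $\{(u,v)\mid\exists p\notin P:(u,p,v)\in E\}$; $\pi^-$, $\pi\cdot\pi'$, $\pi\cup\pi'$: converse, composition, union. Satisfaction of common shapes for $v\in\mathcal N\cup\mathcal V$: $\mathcal G,v\models\exists^{\le n}\pi$ (resp. $\exists^{\ge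 n}\pi$) iff $\#\{v'\mid(v,v')\in[\![\pi]\!]^{\mathcal G}\}\le n$ (resp. $\ge n$); $\wedge$ is conjunction. **Common selectors** are common shapes of one of the forms $\exists k$, $\exists\,p\cdot\pi$, $\exists\,p^-\cdot\pi$, $\exists\,[k=c]\cdot\pi$, $\exists\,(\{k:\mathbb v\}\&\top)\cdot\pi$, $\exists\,k^-\cdot\pi$, where $\pi=\bar\pi$ or $\pi=\bar\pi\cdot k'$ with $\bar\pi$ generated by the grammar above. A common schema is a finite set of pairs (common selector, common shape). **SHACL.** Path expressions: $\pi::=\mathsf{id}\mid q\mid\pi^-\mid\pi\cdot\pi\mid\pi\cup\pi\mid\pi^*$ with $q\in\mathcal P\cup\mathcal K$; $[\![\mathsf{id}]\!]^{\mathcal G}$ is the identity on $\mathcal N\cup\mathcal V$, $[\![q]\!]^{\mathcal G}=\{(v,u)\mid(v,q,u)\in\mathcal G\}$, and the other operators are converse, composition, union, reflexive-transitive closure on $\mathcal N\cup\mathcal V$. Shapes: $\varphi::=\top\mid\mathsf{test}(c)\mid\mathsf{test}(\mathbb v)\mid\mathsf{closed}(Q)\mid\mathsf{eq}(\pi,p)\mid\mathsf{disj}(\pi,p)\mid\neg\varphi\mid\varphi\wedge\varphi\mid\varphi\vee\varphi\mid\exists^{\ge n}\pi.\varphi\mid\exists^{\le n}\pi.\varphi$ with $c\in\mathcal V$, $\mathbb v\in\mathcal T$, $Q\subseteq\mathcal P\cup\mathcal K$ finite, $p\in\mathcal P$, $n\in\mathbb N$. Satisfaction $\mathcal G,v\models\varphi$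 for $v\in\mathcal N\cup\mathcal V$: $\top$ always; $\mathsf{test}(c)$: $v=c$; $\mathsf{test}(\mathbb v)$: $v\in[\![\mathbb v]\!]$; $\mathsf{closed}(Q)$: there is no $q\in(\mathcal P\cup\mathcal K)\setminus Q$ and $u$ with $(v,q,u)\in\mathcal G$; $\mathsf{eq}(\pi,p)$ (resp. $\mathsf{disj}(\pi,p)$): the sets $\{u\mid(v,u)\in[\![\pi]\!]^{\mathcal G}\}$ and $\{u\mid(v,u)\in[\![p]\!]^{\mathcal G}\}$ are equal (resp. disjoint); Boolean connectives as usual; $\exists^{\ge n}\pi.\varphi$ (resp. $\exists^{\le n}$): $\#\{u\mid(v,u)\in[\![\pi]\!]^{\mathcal G},\ \mathcal G,u\models\varphi\}\ge n$ (resp. $\le n$). SHACL selectors: $\exists^{\ge1}q.\top$, $\exists^{\ge1}q^-.\top$, $\mathsf{test}(c)$ with $q\in\mathcal P\cup\mathcal K$, $c\in\mathcal V$. **ShEx.** Shapes $\varphi$ and closed triple expressions $e$ are defined by mutual recursion: $\varphi::=\mathsf{test}(c)\mid\mathsf{test}(\mathbb v)\mid\{e;(\neg R^-)^*\}\mid\{e;(\neg R^-)^*;(\neg Q)^*\}\mid\varphi\wedge\varphi\mid\varphi\vee\varphi\mid\neg\varphi$ and $e::=\varepsilon\mid q.\varphi\mid q^-.\varphi\mid e;e\mid e\,|\,e\mid e^*$, with $c\in\mathcal V$, $\mathbb v\in\mathcal T$, $q\in\mathcal P\cup\mathcal K$, $R,Q\subseteq\mathcal P\cup\mathcal K$ finite.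 For each $q\in\mathcal P\cup\mathcal K$, $q^-$ is a fresh label; $\mathcal E^-=(\mathcal N\times\{p^-\mid p\in\mathcal P\}\times\mathcal N)\cup(\mathcal V\times\{k^-\mid k\in\mathcal K\}\times\mathcal N)$; $\mathsf{Neigh}^{\pm}_{\mathcal G}(v)=\{(v,q,v')\mid(v,q,v')\in\mathcal G\}\cup\{(v,q^-,v')\mid(v',q,v)\in\mathcal G\}$. Triple expressions (including $\neg Q$ and $\neg R^-$) denote families $[\![e]\!]^{\mathcal G}_v$ of subsets of $\mathcal E\cup\mathcal E^-$: $\varepsilon$: $\{\emptyset\}$; $q.\varphi$: all $\{(v,q,v')\}\subseteq\mathcal E$ with $\mathcal G,v'\models\varphi$; $q^-.\varphi$: all $\{(v,q^-,v')\}\subseteq\mathcal E^-$ with $\mathcal G,v'\models\varphi$; $e_1;e_2$: all $T_1\cup T_2$ with $T_i\in[\![e_i]\!]^{\mathcal G}_v$, $T_1\cap T_2=\emptyset$; $e_1|e_2$: union of the families; $e^*$: $\emptyset$ and all finite unions $T_1\cup\dots\cup T_n$ of pairwise disjoint members of $[\![e]\!]^{\mathcal G}_v$; $\neg Q$: all $\{(v,q,v')\}\subseteq\mathcal E$ with $q\notin Q$; $\neg R^-$: all $\{(v,q^-,v')\}\subseteq\mathcal E^-$ with $q\notin R$. Satisfaction: $\mathsf{test}(c)$: $v=c$; $\mathsf{test}(\mathbb v)$: $v\in[\![\mathbb v]\!]$; $\{f\}$: $\mathsf{Neigh}^{\pm}_{\mathcal G}(v)\in[\![f]\!]^{\mathcal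 G}_v$; Boolean connectives as usual. Let $\top$ (in ShEx) abbreviate $\varepsilon;(\neg\emptyset^-)^*;(\neg\emptyset)^*$, and let $e;\top$ abbreviate $e;(\neg\emptyset^-)^*;(\neg\emptyset)^*$. ShEx selectors: $\mathsf{test}(c)$, $\{q.\mathsf{test}(c);\top\}$, $\{q.\{\top\};\top\}$, $\{q^-.\{\top\};\top\}$ with $q\in\mathcal P\cup\mathcal K$, $c\in\mathcal V$. *)

theory Defs
  imports Main "HOL-Library.Countable" "HOL-Library.FSet" "HOL-Library.Disjoint_Sets"
begin

section \<open>Common graphs\<close>

text \<open>
  The pairwise disjoint sets of nodes, values, predicates and keys are four types
  \<open>'n\<close>, \<open>'v\<close>, \<open>'p\<close>, \<open>'k\<close>; the unions of nodes with values and of predicates with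
  keys are the following disjoint sums.
\<close>

datatype ('n, 'v) elem = Node 'n | Val 'v

datatype ('p, 'k) label = Pred 'p | Key 'k

type_synonym ('n, 'p, 'k, 'v) triple = "('n, 'v) elem \<times> ('p, 'k) label \<times> ('n, 'v) elem"

record ('n, 'p, 'k, 'v) cgraph =
  edges :: "('n \<times> 'p \<times> 'n) set"
  props :: "('n \<times> 'k) \<rightharpoonup> 'v"

definition common_graph :: "('n, 'p, 'k, 'v) cgraph \<Rightarrow> bool" where
  "common_graph G \<longleftrightarrow> finite (edges G) \<and> finite (dom (props G))"

definition triples :: "('n, 'p, 'k, 'v) cgraph \<Rightarrow> ('n, 'p, 'k, 'v) triple set" where
  "triples G =
     {(Node u, Pred p, Node v) | u p v. (u, p, v) \<in> edges G} \<union>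
     {(Node u, Key k, Val w) | u k w. props G (u, k) = Some w}"

definition all_triples :: "('n, 'p, 'k, 'v) triple set" where
  "all_triples =
     {(Node u, Pred p, Node v) | u p v. True} \<union> {(Node u, Key k, Val w) | u k w. True}"

definition Nodes :: "('n, 'p, 'k, 'v) cgraph \<Rightarrow> 'n set" where
  "Nodes G =
     {u. (\<exists>p v. (u, p, v) \<in> edges G) \<or> (\<exists>v p. (v, p, u) \<in> edges G) \<or>
         (\<exists>k. (u, k) \<in> dom (props G))}"

definition records :: "('k \<times> 'v) set set" where
  "records = {r. finite r \<and> single_valued r}"

definition record_at :: "('n, 'p, 'k, 'v) cgraph \<Rightarrow> 'n \<Rightarrow> ('k \<times> 'v) set" where
  "record_at G u = {(k, w). props G (u, k) = Some w}"

text \<open>Cardinality comparisons that are also correct for infinite sets.\<close>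

definition at_least :: "nat \<Rightarrow> 'a set \<Rightarrow> bool" where
  "at_least n A \<longleftrightarrow> infinite A \<or> n \<le> card A"

definition at_most :: "nat \<Rightarrow> 'a set \<Rightarrow> bool" where
  "at_most n A \<longleftrightarrow> finite A \<and> card A \<le> n"

text \<open>
  Satisfaction of a schema, relative to the satisfaction relation of the schema language
  on a fixed graph. In each language selectors are particular shapes.
\<close>

definition schema_sat ::
    "(('n, 'v) elem \<Rightarrow> 'shape \<Rightarrow> bool) \<Rightarrow> ('shape \<times> 'shape) set \<Rightarrow> bool" where
  "schema_sat sat S \<longleftrightarrow> (\<forall>v. \<forall>(sel, \<phi>) \<in> S. sat v sel \<longrightarrow> sat v \<phi>)"


section \<open>Common schemas\<close>

text \<open>
  In all three languages the parameter \<open>vt\<close> interprets each value type as a set of values.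
\<close>

datatype ('k, 't) content =
    CTop
  | CEmpty
  | CField 'k 't
  | CBoth "('k, 't) content" "('k, 't) content"
  | CEither "('k, 't) content" "('k, 't) content"

primrec content_sem :: "('t \<Rightarrow> 'v set) \<Rightarrow> ('k, 't) content \<Rightarrow> ('k \<times> 'v) set set" where
  "content_sem vt CTop = records"
| "content_sem vt CEmpty = {{}}"
| "content_sem vt (CField k t) = {{(k, w)} | w. w \<in> vt t}"
| "content_sem vt (CBoth c1 c2) =
     {r1 \<union> r2 | r1 r2. r1 \<in> content_sem vt c1 \<and> r2 \<in> content_sem vt c2 \<and> r1 \<union> r2 \<in> records}"
| "content_sem vt (CEither c1 c2) = content_sem vt c1 \<union> content_sem vt c2"

inductive closed_content :: "('k, 't) content \<Rightarrow> bool" where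
  "closed_content CEmpty"
| "closed_content (CField k t)"
| "closed_content c1 \<Longrightarrow> closed_content c2 \<Longrightarrow> closed_content (CBoth c1 c2)"
| "closed_content c1 \<Longrightarrow> closed_content c2 \<Longrightarrow> closed_content (CEither c1 c2)"

text \<open>
  All path expressions; the sublanguages of the grammar are carved out by the predicates
  \<open>pi0\<close>, \<open>pi1\<close>, \<open>pibar\<close> and \<open>cpath_pi\<close> below. \<open>PNotPreds P\<close> is the path \<open>\<not>P\<close>.
\<close>

datatype ('p, 'k, 'v, 't) cpath =
    PTest 'k 'v
  | PNotTest 'k 'v
  | PContent "('k, 't) content"
  | PNotContent "('k, 't) content"
  | PKey 'k
  | PPred 'p
  | PNotPreds "'p fset"
  | PConv "('p, 'k, 'v, 't) cpath"
  | PComp "('p, 'k, 'v, 't) cpath" "('p, 'k, 'v, 't) cpath"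
  | PUnion "('p, 'k, 'v, 't) cpath" "('p, 'k, 'v, 't) cpath"

primrec cpath_sem ::
    "('t \<Rightarrow> 'v set) \<Rightarrow> ('n, 'p, 'k, 'v) cgraph \<Rightarrow> ('p, 'k, 'v, 't) cpath \<Rightarrow> ('n, 'v) elem rel" where
  "cpath_sem vt G (PTest k c) =
     {(Node u, Node u) | u. u \<in> Nodes G \<and> (k, c) \<in> record_at G u}"
| "cpath_sem vt G (PNotTest k c) =
     {(Node u, Node u) | u. u \<in> Nodes G \<and> (k, c) \<notin> record_at G u}"
| "cpath_sem vt G (PContent c) =
     {(Node u, Node u) | u. u \<in> Nodes G \<and> record_at G u \<in> content_sem vt c}"
| "cpath_sem vt G (PNotContent c) =
     {(Node u, Node u) | u. u \<in> Nodes G \<and> record_at G u \<notin> content_sem vt c}"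
| "cpath_sem vt G (PKey k) = {(Node u, Val w) | u w. props G (u, k) = Some w}"
| "cpath_sem vt G (PPred p) = {(Node u, Node v) | u v. (u, p, v) \<in> edges G}"
| "cpath_sem vt G (PNotPreds P) =
     {(Node u, Node v) | u v. \<exists>p. p |\<notin>| P \<and> (u, p, v) \<in> edges G}"
| "cpath_sem vt G (PConv \<pi>) = (cpath_sem vt G \<pi>)\<inverse>"
| "cpath_sem vt G (PComp \<pi> \<pi>') = cpath_sem vt G \<pi> O cpath_sem vt G \<pi>'"
| "cpath_sem vt G (PUnion \<pi> \<pi>') = cpath_sem vt G \<pi> \<union> cpath_sem vt G \<pi>'"

inductive pi0 :: "('p, 'k, 'v, 't) cpath \<Rightarrow> bool" where
  "pi0 (PTest k c)"
| "pi0 (PNotTest k c)"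
| "closed_content c \<Longrightarrow> pi0 (PContent (CBoth c CTop))"
| "closed_content c \<Longrightarrow> pi0 (PNotContent (CBoth c CTop))"
| "pi0 \<pi> \<Longrightarrow> pi0 \<pi>' \<Longrightarrow> pi0 (PComp \<pi> \<pi>')"

inductive pi1 :: "('p, 'k, 'v, 't) cpath \<Rightarrow> bool" where
  "pi0 \<pi> \<Longrightarrow> pi0 \<pi>' \<Longrightarrow> pi1 (PComp (PComp \<pi> (PPred p)) \<pi>')"
| "pi0 \<pi> \<Longrightarrow> pi0 \<pi>' \<Longrightarrow> pi1 (PComp (PComp \<pi> (PConv (PPred p))) \<pi>')"
| "pi0 \<pi> \<Longrightarrow> pi1 (PComp \<pi> (PKey k))"
| "pi0 \<pi> \<Longrightarrow> pi1 (PComp (PConv (PKey k)) \<pi>)"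

inductive pibar :: "('p, 'k, 'v, 't) cpath \<Rightarrow> bool" where
  "pi0 \<pi> \<Longrightarrow> pibar \<pi>"
| "pibar (PPred p)"
| "pibar \<pi> \<Longrightarrow> pibar (PConv \<pi>)"
| "pibar \<pi> \<Longrightarrow> pibar \<pi>' \<Longrightarrow> pibar (PComp \<pi> \<pi>')"
| "pibar \<pi> \<Longrightarrow> pibar \<pi>' \<Longrightarrow> pibar (PUnion \<pi> \<pi>')"

inductive cpath_pi :: "('p, 'k, 'v, 't) cpath \<Rightarrow> bool" where
  "pibar \<pi> \<Longrightarrow> cpath_pi \<pi>"
| "pibar \<pi> \<Longrightarrow> cpath_pi (PComp \<pi> (PKey k))"
| "pibar \<pi> \<Longrightarrow> cpath_pi (PComp (PConv (PKey k)) \<pi>)"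
| "pibar \<pi> \<Longrightarrow> cpath_pi (PComp (PComp (PConv (PKey k)) \<pi>) (PKey k'))"

datatype ('p, 'k, 'v, 't) cshape =
    CAtMost nat "('p, 'k, 'v, 't) cpath"
  | CAtLeast nat "('p, 'k, 'v, 't) cpath"
  | CAnd "('p, 'k, 'v, 't) cshape" "('p, 'k, 'v, 't) cshape"

abbreviation CExists :: "('p, 'k, 'v, 't) cpath \<Rightarrow> ('p, 'k, 'v, 't) cshape" where
  "CExists \<pi> \<equiv> CAtLeast 1 \<pi>"

abbreviation CNotExists :: "('p, 'k, 'v, 't) cpath \<Rightarrow> ('p, 'k, 'v, 't) cshape" where
  "CNotExists \<pi> \<equiv> CAtMost 0 \<pi>"

primrec common_sat ::
    "('t \<Rightarrow> 'v set) \<Rightarrow> ('n, 'p, 'k, 'v) cgraph \<Rightarrow> ('n, 'v) elem \<Rightarrow> ('p, 'k, 'v, 't) cshape \<Rightarrow> bool"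
  where
  "common_sat vt G v (CAtMost n \<pi>) = at_most n {v'. (v, v') \<in> cpath_sem vt G \<pi>}"
| "common_sat vt G v (CAtLeast n \<pi>) = at_least n {v'. (v, v') \<in> cpath_sem vt G \<pi>}"
| "common_sat vt G v (CAnd \<phi> \<psi>) = (common_sat vt G v \<phi> \<and> common_sat vt G v \<psi>)"

inductive common_shape :: "('p, 'k, 'v, 't) cshape \<Rightarrow> bool" where
  "cpath_pi \<pi> \<Longrightarrow> common_shape (CExists \<pi>)"
| "pi1 \<pi> \<Longrightarrow> common_shape (CAtMost n \<pi>)"
| "pi1 \<pi> \<Longrightarrow> common_shape (CAtLeast n \<pi>)"
| "closed_content c \<Longrightarrow>
     common_shape (CAnd (CExists (PContent c)) (CNotExists (PNotPreds P)))"
| "common_shape \<phi> \<Longrightarrow> common_shape \<psi> \<Longrightarrow> common_shape (CAnd \<phi> \<psi>)"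

text \<open>
  A selector is \<open>\<exists>k\<close>, where the bare path \<open>k\<close> stands for \<open>({} & \<top>) \<cdot> k\<close>, or
  \<open>\<exists> h \<cdot> \<pi>\<close> with one of five kinds of head \<open>h\<close> and \<open>\<pi>\<close> of the form \<open>\<pi>'\<close> or
  \<open>\<pi>' \<cdot> k'\<close> with \<open>pibar \<pi>'\<close>. Composition is associated as in \<open>cpath_pi\<close>, so that
  selectors are literally shapes.
\<close>

inductive selector_head :: "('p, 'k, 'v, 't) cpath \<Rightarrow> bool" where
  "selector_head (PPred p)"
| "selector_head (PConv (PPred p))"
| "selector_head (PTest k c)"
| "selector_head (PContent (CBoth (CField k t) CTop))"
| "selector_head (PConv (PKey k))"

inductive common_selector :: "('p, 'k, 'v, 't) cshape \<Rightarrow> bool" where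
  "common_selector (CExists (PComp (PContent (CBoth CEmpty CTop)) (PKey k)))"
| "selector_head h \<Longrightarrow> pibar \<pi> \<Longrightarrow> common_selector (CExists (PComp h \<pi>))"
| "selector_head h \<Longrightarrow> pibar \<pi> \<Longrightarrow> common_selector (CExists (PComp (PComp h \<pi>) (PKey k')))"

lemma common_selector_imp_common_shape: "common_selector \<phi> \<Longrightarrow> common_shape \<phi>"
  by (induction rule: common_selector.induct)
     (auto 4 8 simp del: One_nat_def elim!: selector_head.cases
        intro!: common_shape.intros(1) intro: cpath_pi.intros pibar.intros pi0.intros
          closed_content.intros)

definition common_schema ::
    "(('p, 'k, 'v, 't) cshape \<times> ('p, 'k, 'v, 't) cshape) set \<Rightarrow> bool" where
  "common_schema S \<longleftrightarrow>
     finite S \<and> (\<forall>(sel, \<phi>) \<in> S. common_selector sel \<and> common_shape \<phi>)"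


section \<open>SHACL\<close>

datatype ('p, 'k) spath =
    SId
  | SStep "('p, 'k) label"
  | SConv "('p, 'k) spath"
  | SComp "('p, 'k) spath" "('p, 'k) spath"
  | SUnion "('p, 'k) spath" "('p, 'k) spath"
  | SStar "('p, 'k) spath"

primrec spath_sem :: "('n, 'p, 'k, 'v) cgraph \<Rightarrow> ('p, 'k) spath \<Rightarrow> ('n, 'v) elem rel" where
  "spath_sem G SId = Id"
| "spath_sem G (SStep q) = {(v, u). (v, q, u) \<in> triples G}"
| "spath_sem G (SConv \<pi>) = (spath_sem G \<pi>)\<inverse>"
| "spath_sem G (SComp \<pi> \<pi>') = spath_sem G \<pi> O spath_sem G \<pi>'"
| "spath_sem G (SUnion \<pi> \<pi>') = spath_sem G \<pi> \<union> spath_sem G \<pi>'"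
| "spath_sem G (SStar \<pi>) = (spath_sem G \<pi>)\<^sup>*"

datatype ('p, 'k, 'v, 't) sshape =
    STop
  | STestValue 'v
  | STestType 't
  | SClosed "('p, 'k) label fset"
  | SEq "('p, 'k) spath" 'p
  | SDisj "('p, 'k) spath" 'p
  | SNot "('p, 'k, 'v, 't) sshape"
  | SAnd "('p, 'k, 'v, 't) sshape" "('p, 'k, 'v, 't) sshape"
  | SOr "('p, 'k, 'v, 't) sshape" "('p, 'k, 'v, 't) sshape"
  | SAtLeast nat "('p, 'k) spath" "('p, 'k, 'v, 't) sshape"
  | SAtMost nat "('p, 'k) spath" "('p, 'k, 'v, 't) sshape"

primrec shacl_sat ::
    "('t \<Rightarrow> 'v set) \<Rightarrow> ('n, 'p, 'k, 'v) cgraph \<Rightarrow> ('n, 'v) elem \<Rightarrow> ('p, 'k, 'v, 't) sshape \<Rightarrow> bool"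
  where
  "shacl_sat vt G v STop = True"
| "shacl_sat vt G v (STestValue c) = (v = Val c)"
| "shacl_sat vt G v (STestType t) = (v \<in> Val ` vt t)"
| "shacl_sat vt G v (SClosed Q) = (\<not> (\<exists>q u. q |\<notin>| Q \<and> (v, q, u) \<in> triples G))"
| "shacl_sat vt G v (SEq \<pi> p) =
     ({u. (v, u) \<in> spath_sem G \<pi>} = {u. (v, u) \<in> spath_sem G (SStep (Pred p))})"
| "shacl_sat vt G v (SDisj \<pi> p) =
     ({u. (v, u) \<in> spath_sem G \<pi>} \<inter> {u. (v, u) \<in> spath_sem G (SStep (Pred p))} = {})"
| "shacl_sat vt G v (SNot \<phi>) = (\<not> shacl_sat vt G v \<phi>)"
| "shacl_sat vt G v (SAnd \<phi> \<psi>) = (shacl_sat vt G v \<phi> \<and> shacl_sat vt G v \<psi>)"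
| "shacl_sat vt G v (SOr \<phi> \<psi>) = (shacl_sat vt G v \<phi> \<or> shacl_sat vt G v \<psi>)"
| "shacl_sat vt G v (SAtLeast n \<pi> \<phi>) =
     at_least n {u. (v, u) \<in> spath_sem G \<pi> \<and> shacl_sat vt G u \<phi>}"
| "shacl_sat vt G v (SAtMost n \<pi> \<phi>) =
     at_most n {u. (v, u) \<in> spath_sem G \<pi> \<and> shacl_sat vt G u \<phi>}"

inductive shacl_selector :: "('p, 'k, 'v, 't) sshape \<Rightarrow> bool" where
  "shacl_selector (SAtLeast 1 (SStep q) STop)"
| "shacl_selector (SAtLeast 1 (SConv (SStep q)) STop)"
| "shacl_selector (STestValue c)"

definition shacl_schema ::
    "(('p, 'k, 'v, 't) sshape \<times> ('p, 'k, 'v, 't) sshape) set \<Rightarrow> bool" where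
  "shacl_schema S \<longleftrightarrow> finite S \<and> (\<forall>(sel, \<phi>) \<in> S. shacl_selector sel)"


section \<open>ShEx\<close>

text \<open>\<open>Inv q\<close> is the fresh label \<open>q\<^sup>-\<close>.\<close>

datatype ('p, 'k) dlabel = Dir "('p, 'k) label" | Inv "('p, 'k) label"

type_synonym ('n, 'p, 'k, 'v) dtriple = "('n, 'v) elem \<times> ('p, 'k) dlabel \<times> ('n, 'v) elem"

definition all_dir :: "('n, 'p, 'k, 'v) dtriple set" where
  "all_dir = {(v, Dir q, v') | v q v'. (v, q, v') \<in> all_triples}"

definition all_inv :: "('n, 'p, 'k, 'v) dtriple set" where
  "all_inv =
     {(Node u, Inv (Pred p), Node v) | u p v. True} \<union> {(Val w, Inv (Key k), Node u) | w k u. True}"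

definition neigh :: "('n, 'p, 'k, 'v) cgraph \<Rightarrow> ('n, 'v) elem \<Rightarrow> ('n, 'p, 'k, 'v) dtriple set" where
  "neigh G v =
     {(v, Dir q, v') | q v'. (v, q, v') \<in> triples G} \<union>
     {(v, Inv q, v') | q v'. (v', q, v) \<in> triples G}"

definition fam_seq :: "'a set set \<Rightarrow> 'a set set \<Rightarrow> 'a set set" where
  "fam_seq A B = {T1 \<union> T2 | T1 T2. T1 \<in> A \<and> T2 \<in> B \<and> T1 \<inter> T2 = {}}"

definition fam_star :: "'a set set \<Rightarrow> 'a set set" where
  "fam_star A =
     {(\<Union>i<n. T i) | (n :: nat) T. (\<forall>i<n. T i \<in> A) \<and> disjoint_family_on T {..<n}}"

definition not_dir :: "('p, 'k) label fset \<Rightarrow> ('n, 'v) elem \<Rightarrow> ('n, 'p, 'k, 'v) dtriple set set" where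
  "not_dir Q v = {{(v, Dir q, v')} | q v'. (v, Dir q, v') \<in> all_dir \<and> q |\<notin>| Q}"

definition not_inv :: "('p, 'k) label fset \<Rightarrow> ('n, 'v) elem \<Rightarrow> ('n, 'p, 'k, 'v) dtriple set set" where
  "not_inv R v = {{(v, Inv q, v')} | q v'. (v, Inv q, v') \<in> all_inv \<and> q |\<notin>| R}"

text \<open>
  \<open>XNeigh e R\<close> is \<open>{e; (\<not>R\<^sup>-)\<^sup>*}\<close> and \<open>XNeighOpen e R Q\<close> is \<open>{e; (\<not>R\<^sup>-)\<^sup>*; (\<not>Q)\<^sup>*}\<close>.
\<close>

datatype ('p, 'k, 'v, 't) xshape =
    XTestValue 'v
  | XTestType 't
  | XNeigh "('p, 'k, 'v, 't) xexpr" "('p, 'k) label fset"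
  | XNeighOpen "('p, 'k, 'v, 't) xexpr" "('p, 'k) label fset" "('p, 'k) label fset"
  | XAnd "('p, 'k, 'v, 't) xshape" "('p, 'k, 'v, 't) xshape"
  | XOr "('p, 'k, 'v, 't) xshape" "('p, 'k, 'v, 't) xshape"
  | XNot "('p, 'k, 'v, 't) xshape"
and ('p, 'k, 'v, 't) xexpr =
    XEps
  | XDir "('p, 'k) label" "('p, 'k, 'v, 't) xshape"
  | XInv "('p, 'k) label" "('p, 'k, 'v, 't) xshape"
  | XSeq "('p, 'k, 'v, 't) xexpr" "('p, 'k, 'v, 't) xexpr"
  | XAlt "('p, 'k, 'v, 't) xexpr" "('p, 'k, 'v, 't) xexpr"
  | XStar "('p, 'k, 'v, 't) xexpr"

primrec shex_sat ::
    "('t \<Rightarrow> 'v set) \<Rightarrow> ('n, 'p, 'k, 'v) cgraph \<Rightarrow> ('p, 'k, 'v, 't) xshape \<Rightarrow> ('n, 'v) elem \<Rightarrow> bool"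
and xexpr_sem ::
    "('t \<Rightarrow> 'v set) \<Rightarrow> ('n, 'p, 'k, 'v) cgraph \<Rightarrow> ('p, 'k, 'v, 't) xexpr \<Rightarrow> ('n, 'v) elem
      \<Rightarrow> ('n, 'p, 'k, 'v) dtriple set set"
  where
  "shex_sat vt G (XTestValue c) = (\<lambda>v. v = Val c)"
| "shex_sat vt G (XTestType t) = (\<lambda>v. v \<in> Val ` vt t)"
| "shex_sat vt G (XNeigh e R) =
     (\<lambda>v. neigh G v \<in> fam_seq (xexpr_sem vt G e v) (fam_star (not_inv R v)))"
| "shex_sat vt G (XNeighOpen e R Q) =
     (\<lambda>v. neigh G v \<in>
        fam_seq (fam_seq (xexpr_sem vt G e v) (fam_star (not_inv R v))) (fam_star (not_dir Q v)))"
| "shex_sat vt G (XAnd \<phi> \<psi>) = (\<lambda>v. shex_sat vt G \<phi> v \<and> shex_sat vt G \<psi> v)"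
| "shex_sat vt G (XOr \<phi> \<psi>) = (\<lambda>v. shex_sat vt G \<phi> v \<or> shex_sat vt G \<psi> v)"
| "shex_sat vt G (XNot \<phi>) = (\<lambda>v. \<not> shex_sat vt G \<phi> v)"
| "xexpr_sem vt G XEps = (\<lambda>v. {{}})"
| "xexpr_sem vt G (XDir q \<phi>) =
     (\<lambda>v. {{(v, Dir q, v')} | v'. (v, Dir q, v') \<in> all_dir \<and> shex_sat vt G \<phi> v'})"
| "xexpr_sem vt G (XInv q \<phi>) =
     (\<lambda>v. {{(v, Inv q, v')} | v'. (v, Inv q, v') \<in> all_inv \<and> shex_sat vt G \<phi> v'})"
| "xexpr_sem vt G (XSeq e1 e2) = (\<lambda>v. fam_seq (xexpr_sem vt G e1 v) (xexpr_sem vt G e2 v))"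
| "xexpr_sem vt G (XAlt e1 e2) = (\<lambda>v. xexpr_sem vt G e1 v \<union> xexpr_sem vt G e2 v)"
| "xexpr_sem vt G (XStar e) = (\<lambda>v. fam_star (xexpr_sem vt G e v))"

text \<open>\<open>XOpen e\<close> is the shape \<open>{e; \<top>}\<close>, and \<open>XTop\<close> is \<open>{\<top>}\<close>.\<close>

abbreviation XOpen :: "('p, 'k, 'v, 't) xexpr \<Rightarrow> ('p, 'k, 'v, 't) xshape" where
  "XOpen e \<equiv> XNeighOpen e {||} {||}"

abbreviation XTop :: "('p, 'k, 'v, 't) xshape" where
  "XTop \<equiv> XOpen XEps"

inductive shex_selector :: "('p, 'k, 'v, 't) xshape \<Rightarrow> bool" where
  "shex_selector (XTestValue c)"
| "shex_selector (XOpen (XDir q (XTestValue c)))"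
| "shex_selector (XOpen (XDir q XTop))"
| "shex_selector (XOpen (XInv q XTop))"

text \<open>Unlike common and SHACL schemas, ShEx schemas need not be finite.\<close>

definition shex_schema ::
    "(('p, 'k, 'v, 't) xshape \<times> ('p, 'k, 'v, 't) xshape) set \<Rightarrow> bool" where
  "shex_schema S \<longleftrightarrow> (\<forall>(sel, \<phi>) \<in> S. shex_selector sel)"


section \<open>Satisfaction of schemas\<close>

definition common_models ::
    "('t \<Rightarrow> 'v set) \<Rightarrow> ('n, 'p, 'k, 'v) cgraph \<Rightarrow>
      (('p, 'k, 'v, 't) cshape \<times> ('p, 'k, 'v, 't) cshape) set \<Rightarrow> bool" where
  "common_models vt G S \<longleftrightarrow> schema_sat (common_sat vt G) S"

definition shacl_models ::
    "('t \<Rightarrow> 'v set) \<Rightarrow> ('n, 'p, 'k, 'v) cgraph \<Rightarrow>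
      (('p, 'k, 'v, 't) sshape \<times> ('p, 'k, 'v, 't) sshape) set \<Rightarrow> bool" where
  "shacl_models vt G S \<longleftrightarrow> schema_sat (shacl_sat vt G) S"

definition shex_models ::
    "('t \<Rightarrow> 'v set) \<Rightarrow> ('n, 'p, 'k, 'v) cgraph \<Rightarrow>
      (('p, 'k, 'v, 't) xshape \<times> ('p, 'k, 'v, 't) xshape) set \<Rightarrow> bool" where
  "shex_models vt G S \<longleftrightarrow> schema_sat (\<lambda>v \<phi>. shex_sat vt G \<phi> v) S"

end

theory Submission
  imports Defs
begin

text \<open>
  Call a property of elements of a graph definable if some SHACL shape and some ShEx shape
  express it at every element that occurs in the graph. Definable properties are closed under
  Boolean operations and under counting the neighbours along one label in either direction;
  so the existence of a common path is definable by recursion on the path, with filters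
  becoming conjunctions and converses pushed down to single steps. A common selector
  implies the existence of an edge with a fixed label, so it can be replaced by a SHACL or ShEx
  selector after moving the rest of it into the premise of the shape.
\<close>

section \<open>Definable properties\<close>

text \<open>The restriction to occurring elements answers an obstacle: a node outside the graph
  satisfies no filter, not even a negated one, yet it satisfies the evident Boolean translation of a
  negated filter. Two facts make the restriction harmless. Both endpoints of a triple occur, so an
  inner shape is evaluated only at neighbours where it is correct; and the relaxed selectors hold
  only at occurring elements. All values count as occurring: filters fail at every value, and values
  are told apart from nodes by a value type. Selectors can be relaxed because their heads contain
  positive filters only, and a positive filter, unlike a negated one, forces a triple.\<close>

definition occurs :: "('n, 'p, 'k, 'v) cgraph \<Rightarrow> ('n, 'v) elem \<Rightarrow> bool" where
  "occurs G v \<longleftrightarrow> v \<in> Node ` Nodes G \<union> range Val"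

text \<open>The shapes are fixed before the graph, so they are uniform in it. Treating both
  languages in one predicate lets each recursion over common syntax be done once.\<close>

definition expresses ::
    "('t \<Rightarrow> 'v set) \<Rightarrow> ('p, 'k, 'v, 't) sshape \<Rightarrow> ('p, 'k, 'v, 't) xshape \<Rightarrow>
      (('n, 'p, 'k, 'v) cgraph \<Rightarrow> ('n, 'v) elem \<Rightarrow> bool) \<Rightarrow> bool" where
  "expresses vt \<phi> \<psi> Q \<longleftrightarrow>
     (\<forall>G v. common_graph G \<longrightarrow> occurs G v \<longrightarrow>
        (shacl_sat vt G v \<phi> \<longleftrightarrow> Q G v) \<and> (shex_sat vt G \<psi> v \<longleftrightarrow> Q G v))"

definition definable ::
    "('t \<Rightarrow> 'v set) \<Rightarrow> (('n, 'p, 'k, 'v) cgraph \<Rightarrow> ('n, 'v) elem \<Rightarrow> bool) \<Rightarrow> bool" where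
  "definable vt Q \<longleftrightarrow> (\<exists>\<phi> \<psi>. expresses vt \<phi> \<psi> Q)"

lemma expressesD:
  assumes "expresses vt \<phi> \<psi> Q" and "common_graph G" and "occurs G v"
  shows "shacl_sat vt G v \<phi> \<longleftrightarrow> Q G v" and "shex_sat vt G \<psi> v \<longleftrightarrow> Q G v"
  using assms unfolding expresses_def by blast+

lemma definableI:
  assumes "\<And>G v. common_graph G \<Longrightarrow> occurs G v \<Longrightarrow> shacl_sat vt G v \<phi> \<longleftrightarrow> Q G v"
    and "\<And>G v. common_graph G \<Longrightarrow> occurs G v \<Longrightarrow> shex_sat vt G \<psi> v \<longleftrightarrow> Q G v"
  shows "definable vt Q"
  unfolding definable_def expresses_def using assms by blast

lemma definable_cong:
  assumes "definable vt Q"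
    and "\<And>G v. common_graph G \<Longrightarrow> occurs G v \<Longrightarrow> Q' G v \<longleftrightarrow> Q G v"
  shows "definable vt Q'"
  using assms unfolding definable_def expresses_def by simp

section \<open>Occurring endpoints and finite neighbourhoods\<close>

lemma triples_occurs:
  "(v, q, u) \<in> triples G \<Longrightarrow> occurs G v" "(v, q, u) \<in> triples G \<Longrightarrow> occurs G u"
  unfolding triples_def occurs_def Nodes_def by (auto intro!: imageI)

lemma triples_subset_all: "triples G \<subseteq> all_triples"
  unfolding triples_def all_triples_def by auto

lemma triples_Inv: "(u, q, v) \<in> triples G \<Longrightarrow> (v, Inv q, u) \<in> all_inv"
  unfolding triples_def all_inv_def by auto

lemma finite_triples:
  assumes "common_graph G"
  shows "finite (triples G)"
proof -
  have "triples G \<subseteq> (\<lambda>(u, p, v). (Node u, Pred p, Node v)) ` edges G \<union>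
      (\<lambda>(u, k). (Node u, Key k, Val (the (props G (u, k))))) ` dom (props G)"
    unfolding triples_def by (force simp: image_iff)
  then show ?thesis
    using assms finite_subset unfolding common_graph_def by fastforce
qed

lemma finite_successors:
  assumes "common_graph G"
  shows "finite {u. (v, q, u) \<in> triples G \<and> P u}"
  by (rule finite_subset[of _ "(\<lambda>(_, _, u). u) ` triples G"])
     (force intro: finite_triples[OF assms])+

lemma finite_predecessors:
  assumes "common_graph G"
  shows "finite {u. (u, q, v) \<in> triples G \<and> P u}"
  by (rule finite_subset[of _ "(\<lambda>(u, _, _). u) ` triples G"])
     (force intro: finite_triples[OF assms])+

lemma neigh_eq:
  "neigh G v = (\<lambda>(v, q, u). (v, Dir q, u)) ` {t \<in> triples G. fst t = v} \<union>
     (\<lambda>(u, q, v). (v, Inv q, u)) ` {t \<in> triples G. snd (snd t) = v}"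
  unfolding neigh_def by (force simp: image_iff)

lemma finite_neigh: "common_graph G \<Longrightarrow> finite (neigh G v)"
  unfolding neigh_eq using finite_triples by force

section \<open>ShEx: repetition, open shapes and counting\<close>

lemma fam_seqI: "T1 \<in> A \<Longrightarrow> T2 \<in> B \<Longrightarrow> T1 \<inter> T2 = {} \<Longrightarrow> T1 \<union> T2 \<in> fam_seq A B"
  unfolding fam_seq_def by blast

lemma fam_seq_Fpow:
  assumes "X \<inter> Y = {}"
  shows "fam_seq (Fpow X) (Fpow Y) = Fpow (X \<union> Y)"
proof (intro equalityI subsetI)
  fix T assume "T \<in> Fpow (X \<union> Y)"
  then have "T = (T \<inter> X) \<union> (T \<inter> Y)" "T \<inter> X \<in> Fpow X" "T \<inter> Y \<in> Fpow Y"
    by (auto simp: Fpow_def)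
  moreover have "(T \<inter> X) \<inter> (T \<inter> Y) = {}"
    using assms by auto
  ultimately show "T \<in> fam_seq (Fpow X) (Fpow Y)"
    using fam_seqI by metis
qed (auto simp: fam_seq_def Fpow_def)

text \<open>A finite set is the disjoint union of its singletons, and an enumeration of it gives the
  family that the star demands. The second hypothesis lets \<open>A\<close> contain the empty set,
  which a choice ending in \<open>XEps\<close> contributes.\<close>

lemma fam_star_singletons:
  assumes "(\<lambda>x. {x}) ` X \<subseteq> A" and "A \<subseteq> insert {} ((\<lambda>x. {x}) ` X)"
  shows "fam_star A = Fpow X"
proof (intro equalityI subsetI)
  fix T assume "T \<in> fam_star A"
  then obtain n :: nat and F where F: "T = (\<Union>i<n. F i)" "\<forall>i<n. F i \<in> A"
    unfolding fam_star_def by blast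
  moreover have "\<forall>B \<in> A. finite B \<and> B \<subseteq> X"
    using assms(2) by auto
  ultimately have "\<forall>i<n. finite (F i) \<and> F i \<subseteq> X"
    by simp
  then show "T \<in> Fpow X"
    unfolding F(1) Fpow_def by auto
next
  fix T assume T: "T \<in> Fpow X"
  then obtain h where h: "bij_betw h {0..<card T} T"
    using ex_bij_betw_nat_finite unfolding Fpow_def by blast
  have "T = (\<Union>i<card T. {h i})"
    using h unfolding bij_betw_def by (auto simp: lessThan_atLeast0)
  moreover have "h i \<in> X" if "i < card T" for i
    using that h T unfolding bij_betw_def Fpow_def by auto
  then have "\<forall>i<card T. {h i} \<in> A"
    using assms(1) by blast
  moreover have "disjoint_family_on (\<lambda>i. {h i}) {..<card T}"
    using h unfolding bij_betw_def disjoint_family_on_def inj_on_def by auto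
  ultimately show "T \<in> fam_star A"
    unfolding fam_star_def by (intro CollectI exI conjI)
qed

lemma fam_star_not_dir:
  "fam_star (not_dir Q v) = Fpow {(v, Dir q, u) | q u. (v, Dir q, u) \<in> all_dir \<and> q |\<notin>| Q}"
  by (rule fam_star_singletons) (auto simp: not_dir_def)

lemma fam_star_not_inv:
  "fam_star (not_inv R v) = Fpow {(v, Inv q, u) | q u. (v, Inv q, u) \<in> all_inv \<and> q |\<notin>| R}"
  by (rule fam_star_singletons) (auto simp: not_inv_def)

text \<open>What \<open>e\<close> leaves of the neighbourhood is split by the kind of label: the
  inverse triples go to the first star, the direct ones to the second. Stars produce finite sets
  only, which is where finiteness of the graph enters.\<close>

lemma shex_sat_open:
  assumes "common_graph G"
  shows "shex_sat vt G (XOpen e) v \<longleftrightarrow> (\<exists>T \<in> xexpr_sem vt G e v. T \<subseteq> neigh G v)"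
proof
  assume "shex_sat vt G (XOpen e) v"
  then show "\<exists>T \<in> xexpr_sem vt G e v. T \<subseteq> neigh G v"
    by (auto simp: fam_seq_def)
next
  assume "\<exists>T \<in> xexpr_sem vt G e v. T \<subseteq> neigh G v"
  then obtain T where T: "T \<in> xexpr_sem vt G e v" "T \<subseteq> neigh G v"
    by blast
  define I where "I = {(w, d, u) \<in> neigh G v - T. \<exists>q. d = Inv q}"
  define D where "D = {(w, d, u) \<in> neigh G v - T. \<exists>q. d = Dir q}"
  have fin: "finite I" "finite D"
    unfolding I_def D_def by (rule finite_subset[OF _ finite_neigh[OF assms, of v]]; blast)+
  have I: "I \<in> fam_star (not_inv {||} v)"
    unfolding fam_star_not_inv Fpow_def using fin triples_Inv
    by (auto simp: I_def neigh_def)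
  have D: "D \<in> fam_star (not_dir {||} v)"
    unfolding fam_star_not_dir Fpow_def using fin triples_subset_all[of G]
    by (auto simp: D_def neigh_def all_dir_def)
  have split: "(T \<union> I) \<union> D = neigh G v" "T \<inter> I = {}" "(T \<union> I) \<inter> D = {}"
    using T(2) by (auto simp: I_def D_def neigh_def)
  show "shex_sat vt G (XOpen e) v"
    using fam_seqI[OF fam_seqI[OF T(1) I split(2)] D split(3)] by (simp add: split(1))
qed

lemma shex_sat_top: "common_graph G \<Longrightarrow> shex_sat vt G XTop v"
  by (simp add: shex_sat_open del: shex_sat.simps)

text \<open>Sequencing demands disjoint parts, so \<open>n\<close> copies of an expression that
  denotes singletons pick \<open>n\<close> different triples. This is how ShEx counts.\<close>

lemma xexpr_sem_pow:
  assumes "xexpr_sem vt G e v = (\<lambda>x. {x}) ` X"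
  shows "xexpr_sem vt G ((XSeq e ^^ n) XEps) v = {T. finite T \<and> card T = n \<and> T \<subseteq> X}"
proof (induction n)
  case 0
  show ?case by auto
next
  case (Suc n)
  show ?case
  proof (intro equalityI subsetI)
    fix T assume "T \<in> xexpr_sem vt G ((XSeq e ^^ Suc n) XEps) v"
    then obtain x T' where "T = insert x T'" "x \<notin> T'" "x \<in> X" "finite T'" "card T' = n" "T' \<subseteq> X"
      by (auto simp: fam_seq_def assms Suc)
    then show "T \<in> {T. finite T \<and> card T = Suc n \<and> T \<subseteq> X}"
      by auto
  next
    fix T assume "T \<in> {T. finite T \<and> card T = Suc n \<and> T \<subseteq> X}"
    then have T: "card T = Suc n" "T \<subseteq> X" "finite T"
      by auto
    obtain x T' where x: "T = insert x T'" "x \<notin> T'" "card T' = n"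
      using card_eq_SucD[OF T(1)] by auto
    then have "finite T'"
      using T(3) by simp
    then have "{x} \<in> (\<lambda>x. {x}) ` X" "T' \<in> {T. finite T \<and> card T = n \<and> T \<subseteq> X}" "{x} \<inter> T' = {}"
        "T = {x} \<union> T'"
      using x T(2) by auto
    then show "T \<in> xexpr_sem vt G ((XSeq e ^^ Suc n) XEps) v"
      by (simp only: funpow.simps comp_apply xexpr_sem.simps fam_seq_def assms Suc) blast
  qed
qed

lemma ex_subset_card_iff:
  assumes "finite S"
  shows "(\<exists>T. finite T \<and> card T = n \<and> T \<subseteq> S) \<longleftrightarrow> n \<le> card S"
proof
  assume "n \<le> card S"
  then obtain T where "T \<subseteq> S" "card T = n" "finite T"
    by (rule obtain_subset_with_card_n)
  then show "\<exists>T. finite T \<and> card T = n \<and> T \<subseteq> S"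
    by auto
qed (auto intro: card_mono[OF assms])

text \<open>Openness turns exactly \<open>n\<close> matched triples into at least \<open>n\<close>.
  The map \<open>f\<close> sends a neighbour to its labelled triple; injectivity makes counting
  triples the same as counting neighbours.\<close>

lemma shex_sat_open_pow:
  assumes "common_graph G" and "xexpr_sem vt G e v = (\<lambda>x. {x}) ` f ` Y" and "inj f"
  shows "shex_sat vt G (XOpen ((XSeq e ^^ n) XEps)) v \<longleftrightarrow>
    at_least n {u \<in> Y. f u \<in> neigh G v}"
proof -
  let ?Z = "{u \<in> Y. f u \<in> neigh G v}"
  have img: "f ` ?Z = f ` Y \<inter> neigh G v"
    by auto
  then have fin: "finite (f ` ?Z)"
    using finite_neigh[OF assms(1)] by auto
  have inj: "inj_on f ?Z"
    using assms(3) by (rule inj_on_subset) simp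
  have "shex_sat vt G (XOpen ((XSeq e ^^ n) XEps)) v \<longleftrightarrow>
      (\<exists>T. finite T \<and> card T = n \<and> T \<subseteq> f ` ?Z)"
    unfolding shex_sat_open[OF assms(1)] xexpr_sem_pow[OF assms(2)] img
    by (simp add: Bex_def)
  also have "\<dots> \<longleftrightarrow> n \<le> card (f ` ?Z)"
    using fin by (rule ex_subset_card_iff)
  finally show ?thesis
    using fin inj by (simp add: at_least_def card_image finite_image_iff)
qed

section \<open>Closure properties of definability\<close>

lemma definable_True: "definable vt (\<lambda>_ _. True)"
  by (rule definableI[of _ STop _ XTop]) (simp_all add: shex_sat_top del: shex_sat.simps)

lemma definable_not:
  assumes "definable vt Q"
  shows "definable vt (\<lambda>G v. \<not> Q G v)"
proof -
  from assms obtain \<phi> \<psi> where "expresses vt \<phi> \<psi> Q"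
    unfolding definable_def by blast
  note * = expressesD[OF this]
  show ?thesis
    by (rule definableI[of _ "SNot \<phi>" _ "XNot \<psi>"]) (simp_all add: *)
qed

lemma definable_False: "definable vt (\<lambda>_ _. False)"
  using definable_not[OF definable_True] by simp

lemma definable_and:
  assumes "definable vt Q" and "definable vt Q'"
  shows "definable vt (\<lambda>G v. Q G v \<and> Q' G v)"
proof -
  from assms(1) obtain \<phi> \<psi> where "expresses vt \<phi> \<psi> Q"
    unfolding definable_def by blast
  note * = expressesD[OF this]
  from assms(2) obtain \<phi>' \<psi>' where "expresses vt \<phi>' \<psi>' Q'"
    unfolding definable_def by blast
  note ** = expressesD[OF this]
  show ?thesis
    by (rule definableI[of _ "SAnd \<phi> \<phi>'" _ "XAnd \<psi> \<psi>'"]) (simp_all add: * **)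
qed

lemma definable_or:
  assumes "definable vt Q" and "definable vt Q'"
  shows "definable vt (\<lambda>G v. Q G v \<or> Q' G v)"
  using definable_not[OF definable_and[OF definable_not[OF assms(1)] definable_not[OF assms(2)]]]
  by simp

lemma definable_imp:
  assumes "definable vt Q" and "definable vt Q'"
  shows "definable vt (\<lambda>G v. Q G v \<longrightarrow> Q' G v)"
  unfolding imp_conv_disj by (rule definable_or[OF definable_not[OF assms(1)] assms(2)])

lemma definable_Bex:
  assumes "finite A" and "\<And>a. a \<in> A \<Longrightarrow> definable vt (Q a)"
  shows "definable vt (\<lambda>G v. \<exists>a \<in> A. Q a G v)"
  using assms by (induction A) (simp_all add: definable_False definable_or)

lemma definable_Ball:
  assumes "finite A" and "\<And>a. a \<in> A \<Longrightarrow> definable vt (Q a)"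
  shows "definable vt (\<lambda>G v. \<forall>a \<in> A. Q a G v)"
  using assms by (induction A) (simp_all add: definable_True definable_and)

lemma definable_value: "definable vt (\<lambda>_ v. v = Val c)"
  by (rule definableI[of _ "STestValue c" _ "XTestValue c"]) simp_all

lemma definable_value_type: "definable vt (\<lambda>_ v. v \<in> Val ` vt t)"
  by (rule definableI[of _ "STestType t" _ "XTestType t"]) simp_all

text \<open>There is no atomic test for nodes; the value type that contains all values, negated,
  takes its place.\<close>

lemma definable_node:
  fixes vt :: "'t \<Rightarrow> 'v set"
  assumes "UNIV \<in> range vt"
  shows "definable vt (\<lambda>(_ :: ('n, 'p, 'k, 'v) cgraph) v. \<exists>u. v = Node u)"
proof -
  obtain any_type where any: "vt any_type = UNIV"
    using assms by auto
  show ?thesis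
  proof (rule definable_cong[OF definable_not[OF definable_value_type[of _ any_type]]])
    fix v :: "('n, 'v) elem"
    show "(\<exists>u. v = Node u) \<longleftrightarrow> v \<notin> Val ` vt any_type"
      using any by (cases v) auto
  qed
qed

text \<open>The shapes for \<open>Q\<close> are reliable only at occurring elements, and targets of
  triples occur. On the ShEx side the condition of lying in \<open>all_dir\<close> holds for every
  actual triple of the graph.\<close>

lemma definable_successors:
  fixes Q :: "('n, 'p, 'k, 'v) cgraph \<Rightarrow> ('n, 'v) elem \<Rightarrow> bool"
  assumes "definable vt Q"
  shows "definable vt (\<lambda>G v. at_least n {u. (v, q, u) \<in> triples G \<and> Q G u})"
proof -
  from assms obtain \<phi> \<psi> where "expresses vt \<phi> \<psi> Q"
    unfolding definable_def by blast
  note * = expressesD[OF this]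
  show ?thesis
  proof (rule definableI[of _ "SAtLeast n (SStep q) \<phi>" _ "XOpen ((XSeq (XDir q \<psi>) ^^ n) XEps)"])
    fix G :: "('n, 'p, 'k, 'v) cgraph" and v :: "('n, 'v) elem"
    assume G: "common_graph G"
    have "{u. (v, u) \<in> spath_sem G (SStep q) \<and> shacl_sat vt G u \<phi>} =
        {u. (v, q, u) \<in> triples G \<and> Q G u}"
      using *(1)[OF G] triples_occurs(2) by force
    then show "shacl_sat vt G v (SAtLeast n (SStep q) \<phi>) \<longleftrightarrow>
        at_least n {u. (v, q, u) \<in> triples G \<and> Q G u}"
      by simp
    have "xexpr_sem vt G (XDir q \<psi>) v =
        (\<lambda>x. {x}) ` (\<lambda>u. (v, Dir q, u)) ` {u. (v, Dir q, u) \<in> all_dir \<and> shex_sat vt G \<psi> u}"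
      by auto
    moreover have "inj (\<lambda>u. (v, Dir q, u))"
      by (simp add: inj_def)
    ultimately have "shex_sat vt G (XOpen ((XSeq (XDir q \<psi>) ^^ n) XEps)) v \<longleftrightarrow>
        at_least n {u \<in> {u. (v, Dir q, u) \<in> all_dir \<and> shex_sat vt G \<psi> u}. (v, Dir q, u) \<in> neigh G v}"
      by (rule shex_sat_open_pow[OF G])
    also have "{u \<in> {u. (v, Dir q, u) \<in> all_dir \<and> shex_sat vt G \<psi> u}. (v, Dir q, u) \<in> neigh G v} =
        {u. (v, q, u) \<in> triples G \<and> Q G u}"
      using *(2)[OF G] triples_occurs(2)[of v q _ G] triples_subset_all[of G]
      by (auto simp: neigh_def all_dir_def)
    finally show "shex_sat vt G (XOpen ((XSeq (XDir q \<psi>) ^^ n) XEps)) v \<longleftrightarrow>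
        at_least n {u. (v, q, u) \<in> triples G \<and> Q G u}" .
  qed
qed

lemma definable_predecessors:
  fixes Q :: "('n, 'p, 'k, 'v) cgraph \<Rightarrow> ('n, 'v) elem \<Rightarrow> bool"
  assumes "definable vt Q"
  shows "definable vt (\<lambda>G v. at_least n {u. (u, q, v) \<in> triples G \<and> Q G u})"
proof -
  from assms obtain \<phi> \<psi> where "expresses vt \<phi> \<psi> Q"
    unfolding definable_def by blast
  note * = expressesD[OF this]
  show ?thesis
  proof (rule definableI[of _ "SAtLeast n (SConv (SStep q)) \<phi>" _
        "XOpen ((XSeq (XInv q \<psi>) ^^ n) XEps)"])
    fix G :: "('n, 'p, 'k, 'v) cgraph" and v :: "('n, 'v) elem"
    assume G: "common_graph G"
    have "{u. (v, u) \<in> spath_sem G (SConv (SStep q)) \<and> shacl_sat vt G u \<phi>} =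
        {u. (u, q, v) \<in> triples G \<and> Q G u}"
      using *(1)[OF G] triples_occurs(1) by force
    then show "shacl_sat vt G v (SAtLeast n (SConv (SStep q)) \<phi>) \<longleftrightarrow>
        at_least n {u. (u, q, v) \<in> triples G \<and> Q G u}"
      by simp
    have "xexpr_sem vt G (XInv q \<psi>) v =
        (\<lambda>x. {x}) ` (\<lambda>u. (v, Inv q, u)) ` {u. (v, Inv q, u) \<in> all_inv \<and> shex_sat vt G \<psi> u}"
      by auto
    moreover have "inj (\<lambda>u. (v, Inv q, u))"
      by (simp add: inj_def)
    ultimately have "shex_sat vt G (XOpen ((XSeq (XInv q \<psi>) ^^ n) XEps)) v \<longleftrightarrow>
        at_least n {u \<in> {u. (v, Inv q, u) \<in> all_inv \<and> shex_sat vt G \<psi> u}. (v, Inv q, u) \<in> neigh G v}"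
      by (rule shex_sat_open_pow[OF G])
    also have "{u \<in> {u. (v, Inv q, u) \<in> all_inv \<and> shex_sat vt G \<psi> u}. (v, Inv q, u) \<in> neigh G v} =
        {u. (u, q, v) \<in> triples G \<and> Q G u}"
      using *(2)[OF G] triples_occurs(1)[of _ q v G] triples_Inv[of _ q v G]
      by (auto simp: neigh_def)
    finally show "shex_sat vt G (XOpen ((XSeq (XInv q \<psi>) ^^ n) XEps)) v \<longleftrightarrow>
        at_least n {u. (u, q, v) \<in> triples G \<and> Q G u}" .
  qed
qed

lemma at_least_1: "finite A \<Longrightarrow> at_least 1 A \<longleftrightarrow> A \<noteq> {}"
  unfolding at_least_def by (auto simp: Suc_le_eq card_gt_0_iff)

lemma definable_ex_successor:
  assumes "definable vt Q"
  shows "definable vt (\<lambda>G v. \<exists>u. (v, q, u) \<in> triples G \<and> Q G u)"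
  by (rule definable_cong[OF definable_successors[OF assms, of 1 q]])
     (simp add: at_least_1 finite_successors del: One_nat_def)

lemma definable_ex_predecessor:
  assumes "definable vt Q"
  shows "definable vt (\<lambda>G v. \<exists>u. (u, q, v) \<in> triples G \<and> Q G u)"
  by (rule definable_cong[OF definable_predecessors[OF assms, of 1 q]])
     (simp add: at_least_1 finite_predecessors del: One_nat_def)

text \<open>In ShEx, \<open>XNeigh\<close> leaves no open part for direct triples, so all of them
  must be matched by the starred choice among the labels of \<open>Q\<close>; the empty exclusion
  set \<open>{||}\<close> leaves inverse triples free.\<close>

lemma definable_closed:
  fixes Q :: "('p, 'k) label fset" and vt :: "'t \<Rightarrow> 'v set"
  shows "definable vt
    (\<lambda>(G :: ('n, 'p, 'k, 'v) cgraph) v. \<not> (\<exists>q u. q |\<notin>| Q \<and> (v, q, u) \<in> triples G))"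
proof -
  obtain qs where qs: "set qs = fset Q"
    using finite_list[OF finite_fset[of Q]] by auto
  \<comment> \<open>The final \<open>XEps\<close> merely ends the fold: it adds the empty set to the
    denotation, which does not change the star.\<close>
  let ?e = "foldr (\<lambda>q. XAlt (XDir q XTop)) qs XEps"
  show ?thesis
  proof (rule definableI[of _ "SClosed Q" _ "XNeigh (XStar ?e) {||}"])
    fix G :: "('n, 'p, 'k, 'v) cgraph" and v :: "('n, 'v) elem"
    assume G: "common_graph G"
    let ?X = "{(v, Dir q, u) | q u. (v, Dir q, u) \<in> all_dir \<and> q |\<in>| Q}"
    have "xexpr_sem vt G ?e v =
        insert {} ((\<lambda>x. {x}) ` {(v, Dir q, u) | q u. (v, Dir q, u) \<in> all_dir \<and> q \<in> set qs})"
      by (induction qs) (use shex_sat_top[OF G, of vt] in \<open>auto simp del: shex_sat.simps\<close>)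
    then have star: "xexpr_sem vt G (XStar ?e) v = Fpow ?X"
      unfolding xexpr_sem.simps by (intro fam_star_singletons) (auto simp: qs)
    let ?Y = "{(v, Inv q, u) | q u. (v, Inv q, u) \<in> all_inv}"
    have "fam_seq (Fpow ?X) (Fpow ?Y) = Fpow (?X \<union> ?Y)"
      by (rule fam_seq_Fpow) auto
    then have "shex_sat vt G (XNeigh (XStar ?e) {||}) v \<longleftrightarrow> neigh G v \<in> Fpow (?X \<union> ?Y)"
      unfolding shex_sat.simps star fam_star_not_inv by simp
    also have "\<dots> \<longleftrightarrow> neigh G v \<subseteq> ?X \<union> ?Y"
      using finite_neigh[OF G] by (simp add: Fpow_def)
    also have "\<dots> \<longleftrightarrow> \<not> (\<exists>q u. q |\<notin>| Q \<and> (v, q, u) \<in> triples G)"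
    proof
      assume sub: "neigh G v \<subseteq> ?X \<union> ?Y"
      show "\<not> (\<exists>q u. q |\<notin>| Q \<and> (v, q, u) \<in> triples G)"
      proof
        assume "\<exists>q u. q |\<notin>| Q \<and> (v, q, u) \<in> triples G"
        then obtain q u where q: "q |\<notin>| Q" "(v, Dir q, u) \<in> neigh G v"
          by (auto simp: neigh_def)
        from subsetD[OF sub q(2)] q(1) show False
          by simp
      qed
    next
      assume closed: "\<not> (\<exists>q u. q |\<notin>| Q \<and> (v, q, u) \<in> triples G)"
      show "neigh G v \<subseteq> ?X \<union> ?Y"
      proof
        fix x assume "x \<in> neigh G v"
        then consider q u where "x = (v, Dir q, u)" "(v, q, u) \<in> triples G"
          | q u where "x = (v, Inv q, u)" "(u, q, v) \<in> triples G"
          by (auto simp: neigh_def)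
        then show "x \<in> ?X \<union> ?Y"
        proof cases
          case 1
          then show ?thesis
            using closed subsetD[OF triples_subset_all 1(2)] by (auto simp: all_dir_def)
        next
          case 2
          then show ?thesis
            using triples_Inv[OF 2(2)] by simp
        qed
      qed
    qed
    finally show "shex_sat vt G (XNeigh (XStar ?e) {||}) v \<longleftrightarrow>
        \<not> (\<exists>q u. q |\<notin>| Q \<and> (v, q, u) \<in> triples G)" .
  qed simp
qed


section \<open>Content types\<close>

text \<open>
  Membership of the restriction of a record to a finite key set \<open>K\<close> is definable by recursion on a
  closed content type: conjunction ranges over the finitely many ways to cover \<open>K\<close> by two sets.
  The open and the closed reading of a content type both reduce to such restrictions.
\<close>

definition restr :: "'k set \<Rightarrow> ('k \<times> 'v) set \<Rightarrow> ('k \<times> 'v) set" where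
  "restr K r = {x \<in> r. fst x \<in> K}"

primrec content_keys :: "('k, 't) content \<Rightarrow> 'k set" where
  "content_keys CTop = {}"
| "content_keys CEmpty = {}"
| "content_keys (CField k t) = {k}"
| "content_keys (CBoth c1 c2) = content_keys c1 \<union> content_keys c2"
| "content_keys (CEither c1 c2) = content_keys c1 \<union> content_keys c2"

lemma finite_content_keys: "finite (content_keys c)"
  by (induction c) auto

text \<open>Closedness is essential: \<open>CTop\<close> admits records with arbitrary keys. The
  bound makes the later searches over key sets finite.\<close>

lemma Domain_content_sem:
  "closed_content c \<Longrightarrow> r \<in> content_sem vt c \<Longrightarrow> Domain r \<subseteq> content_keys c"
proof (induction arbitrary: r rule: closed_content.induct)
  case (3 c1 c2)
  then obtain r1 r2 where "r = r1 \<union> r2" "r1 \<in> content_sem vt c1" "r2 \<in> content_sem vt c2"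
    by auto
  then show ?case
    using 3(3)[of r1] 3(4)[of r2] by auto
next
  case (4 c1 c2)
  then show ?case
    using 4(3)[of r] 4(4)[of r] by auto
qed auto

lemma record_at_records:
  assumes "common_graph G"
  shows "record_at G u \<in> records"
proof -
  have "record_at G u \<subseteq> (\<lambda>(u', k). (k, the (props G (u', k)))) ` dom (props G)"
    unfolding record_at_def by (force simp: image_iff)
  then have "finite (record_at G u)"
    using assms finite_subset unfolding common_graph_def by blast
  then show ?thesis
    unfolding records_def record_at_def single_valued_def by auto
qed

lemma records_subset: "r \<in> records \<Longrightarrow> r' \<subseteq> r \<Longrightarrow> r' \<in> records"
  unfolding records_def using finite_subset single_valued_subset by blast

text \<open>A record has one value per key, so a subrecord is determined by its keys. Quantifiers
  over subrecords can therefore be replaced by quantifiers over key sets.\<close>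

lemma restr_Domain:
  assumes "r \<in> records" and "r' \<subseteq> r"
  shows "restr (Domain r') r = r'"
proof (intro equalityI subsetI)
  fix x assume "x \<in> restr (Domain r') r"
  then obtain k w w' where "x = (k, w)" "(k, w) \<in> r" "(k, w') \<in> r'"
    unfolding restr_def by (cases x) auto
  then show "x \<in> r'"
    using assms single_valuedD[of r k w w'] unfolding records_def by auto
next
  fix x assume "x \<in> r'"
  then show "x \<in> restr (Domain r') r"
    using assms(2) unfolding restr_def by (cases x) auto
qed

text \<open>The right-hand side speaks of single triples only: one along \<open>k\<close> with a
  value of type \<open>t\<close>, and none along the other keys of \<open>K\<close>.\<close>

lemma restr_CField:
  assumes "r \<in> records"
  shows "restr K r \<in> content_sem vt (CField k t) \<longleftrightarrow>
    k \<in> K \<and> (\<exists>w \<in> vt t. (k, w) \<in> r) \<and> (\<forall>k' \<in> K - {k}. k' \<notin> Domain r)"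
proof
  assume "restr K r \<in> content_sem vt (CField k t)"
  then obtain w where w: "restr K r = {(k, w)}" "w \<in> vt t"
    by auto
  then have "(k, w) \<in> restr K r" "\<And>k' w'. (k', w') \<in> r \<Longrightarrow> k' \<in> K \<Longrightarrow> k' = k"
    unfolding restr_def by auto
  then show "k \<in> K \<and> (\<exists>w \<in> vt t. (k, w) \<in> r) \<and> (\<forall>k' \<in> K - {k}. k' \<notin> Domain r)"
    using w(2) unfolding restr_def by auto
next
  assume *: "k \<in> K \<and> (\<exists>w \<in> vt t. (k, w) \<in> r) \<and> (\<forall>k' \<in> K - {k}. k' \<notin> Domain r)"
  then obtain w where w: "w \<in> vt t" "(k, w) \<in> r"
    by blast
  have "restr K r \<subseteq> {(k, w)}"
  proof
    fix x assume x: "x \<in> restr K r"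
    obtain k' w' where x_eq: "x = (k', w')"
      by (cases x)
    then have r: "(k', w') \<in> r" "k' \<in> K"
      using x by (simp_all add: restr_def)
    then have "k' \<in> Domain r"
      by blast
    then have "k' = k"
      using * r(2) by blast
    moreover from this have "w' = w"
      using single_valuedD[of r k w' w] w(2) r(1) assms by (simp add: records_def)
    ultimately show "x \<in> {(k, w)}"
      using x_eq by simp
  qed
  moreover have "(k, w) \<in> restr K r"
    using * w(2) by (simp add: restr_def)
  ultimately have "restr K r = {(k, w)}"
    by (intro subset_antisym) simp_all
  then show "restr K r \<in> content_sem vt (CField k t)"
    using w(1) by simp
qed

text \<open>The two parts of a conjunction may share fields, so \<open>K1\<close> and
  \<open>K2\<close> cover \<open>K\<close> but need not be disjoint.\<close>

lemma restr_CBoth: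
  assumes "r \<in> records"
  shows "restr K r \<in> content_sem vt (CBoth c1 c2) \<longleftrightarrow>
    (\<exists>K1 \<in> Pow K. \<exists>K2 \<in> {K2 \<in> Pow K. K1 \<union> K2 = K}.
       restr K1 r \<in> content_sem vt c1 \<and> restr K2 r \<in> content_sem vt c2)"
proof
  assume "restr K r \<in> content_sem vt (CBoth c1 c2)"
  then obtain r1 r2 where r: "restr K r = r1 \<union> r2" "r1 \<in> content_sem vt c1" "r2 \<in> content_sem vt c2"
    by auto
  \<comment> \<open>keys of K that do not occur in r may go to either side\<close>
  let ?K1 = "(K - Domain r) \<union> Domain r1"
  have sub: "r1 \<subseteq> r" "r2 \<subseteq> r" "Domain r1 \<subseteq> K" "Domain r2 \<subseteq> K" "?K1 \<union> Domain r2 = K"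
  proof -
    have *: "x \<in> r1 \<or> x \<in> r2 \<longleftrightarrow> x \<in> r \<and> fst x \<in> K" for x
      using r(1) unfolding restr_def by auto
    show "r1 \<subseteq> r" "r2 \<subseteq> r"
      using * by auto
    show "Domain r1 \<subseteq> K" "Domain r2 \<subseteq> K"
      using * by force+
    show "?K1 \<union> Domain r2 = K"
      using * by force
  qed
  have "restr ?K1 r = restr (Domain r1) r"
    unfolding restr_def by auto
  then have "restr ?K1 r = r1" "restr (Domain r2) r = r2"
    using restr_Domain[OF assms] sub by auto
  then show "\<exists>K1 \<in> Pow K. \<exists>K2 \<in> {K2 \<in> Pow K. K1 \<union> K2 = K}.
      restr K1 r \<in> content_sem vt c1 \<and> restr K2 r \<in> content_sem vt c2"
    using r sub by (intro bexI[of _ ?K1] bexI[of _ "Domain r2"]) auto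
next
  assume "\<exists>K1 \<in> Pow K. \<exists>K2 \<in> {K2 \<in> Pow K. K1 \<union> K2 = K}.
      restr K1 r \<in> content_sem vt c1 \<and> restr K2 r \<in> content_sem vt c2"
  then obtain K1 K2 where K: "K1 \<union> K2 = K"
      "restr K1 r \<in> content_sem vt c1" "restr K2 r \<in> content_sem vt c2"
    by auto
  have "restr K r = restr K1 r \<union> restr K2 r"
    unfolding K(1)[symmetric] restr_def by auto
  moreover have "restr K r \<in> records"
    by (rule records_subset[OF assms]) (auto simp: restr_def)
  ultimately show "restr K r \<in> content_sem vt (CBoth c1 c2)"
    using K by auto
qed

text \<open>From left to right, \<open>K\<close> is the key set of the part matched by
  \<open>c\<close>. From right to left, the record \<open>r\<close> itself serves as the member of
  \<open>CTop\<close>.\<close>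

lemma content_open_iff:
  assumes "closed_content c" and "r \<in> records"
  shows "r \<in> content_sem vt (CBoth c CTop) \<longleftrightarrow>
    (\<exists>K \<in> Pow (content_keys c). restr K r \<in> content_sem vt c)"
proof
  assume "r \<in> content_sem vt (CBoth c CTop)"
  then obtain r1 where "r1 \<in> content_sem vt c" "r1 \<subseteq> r"
    by auto
  then have "Domain r1 \<in> Pow (content_keys c)" "restr (Domain r1) r \<in> content_sem vt c"
    using restr_Domain[OF assms(2)] Domain_content_sem[OF assms(1)] by simp_all
  then show "\<exists>K \<in> Pow (content_keys c). restr K r \<in> content_sem vt c"
    by blast
next
  assume "\<exists>K \<in> Pow (content_keys c). restr K r \<in> content_sem vt c"
  then obtain K where "restr K r \<in> content_sem vt c"
    by blast
  moreover have "restr K r \<union> r = r"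
    unfolding restr_def by auto
  ultimately show "r \<in> content_sem vt (CBoth c CTop)"
    using assms(2) unfolding content_sem.simps by (intro CollectI exI[of _ "restr K r"] exI[of _ r]) simp
qed

text \<open>Splits exact membership into a bound on the keys, which a closedness constraint can
  express, and a statement about a fixed finite key set, which \<open>definable_restr\<close>
  covers.\<close>

lemma content_sem_iff:
  assumes "closed_content c"
  shows "r \<in> content_sem vt c \<longleftrightarrow>
    Domain r \<subseteq> content_keys c \<and> restr (content_keys c) r \<in> content_sem vt c"
proof -
  have "restr (content_keys c) r = r" if "Domain r \<subseteq> content_keys c"
    using that unfolding restr_def by fastforce
  then show ?thesis
    using Domain_content_sem[OF assms] by metis
qed

lemma Key_triple_iff:
  "(v, Key k, x) \<in> triples G \<longleftrightarrow> (\<exists>u w. v = Node u \<and> x = Val w \<and> (k, w) \<in> record_at G u)"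
  unfolding triples_def record_at_def by auto

text \<open>\<open>K\<close> has to vary in the induction, since a conjunction passes smaller key
  sets to its parts.\<close>

lemma definable_restr:
  fixes vt :: "'t \<Rightarrow> 'v set" and c :: "('k, 't) content"
  assumes "UNIV \<in> range vt" and "closed_content c" and "finite K"
  shows "definable vt
    (\<lambda>(G :: ('n, 'p, 'k, 'v) cgraph) v. \<exists>u. v = Node u \<and> restr K (record_at G u) \<in> content_sem vt c)"
  using assms(2,3)
proof (induction c arbitrary: K rule: closed_content.induct)
  case 1
  have "definable vt (\<lambda>(G :: ('n, 'p, 'k, 'v) cgraph) v.
      (\<exists>u. v = Node u) \<and> (\<forall>k \<in> K. \<not> (\<exists>x. (v, Key k, x) \<in> triples G \<and> True)))"
    by (intro definable_and definable_node[OF assms(1)] definable_Ball 1 definable_not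
        definable_ex_successor definable_True)
  then show ?case
    by (rule definable_cong) (auto simp: Key_triple_iff restr_def)
next
  case (2 k t)
  show ?case
  proof (cases "k \<in> K")
    case True
    have "definable vt (\<lambda>G v. (\<exists>x. (v, Key k, x) \<in> triples G \<and> x \<in> Val ` vt t) \<and>
        (\<forall>k' \<in> K - {k}. \<not> (\<exists>x. (v, Key k', x) \<in> triples G \<and> True)))"
      by (intro definable_and definable_Ball definable_not definable_ex_successor definable_True
          definable_value_type) (use 2 in simp)
    then show ?thesis
    proof (rule definable_cong)
      fix G :: "('n, 'p, 'k, 'v) cgraph" and v :: "('n, 'v) elem"
      assume "common_graph G"
      note field = restr_CField[OF record_at_records[OF this]]
      show "(\<exists>u. v = Node u \<and> restr K (record_at G u) \<in> content_sem vt (CField k t)) \<longleftrightarrow>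
          (\<exists>x. (v, Key k, x) \<in> triples G \<and> x \<in> Val ` vt t) \<and>
          (\<forall>k' \<in> K - {k}. \<not> (\<exists>x. (v, Key k', x) \<in> triples G \<and> True))"
        using True unfolding field Key_triple_iff by (auto simp: Domain_iff)
    qed
  next
    case False
    show ?thesis
      by (rule definable_cong[OF definable_False])
         (simp only: restr_CField[OF record_at_records] False simp_thms)
  qed
next
  case (3 c1 c2)
  have "definable vt (\<lambda>(G :: ('n, 'p, 'k, 'v) cgraph) v.
      \<exists>K1 \<in> Pow K. \<exists>K2 \<in> {K2 \<in> Pow K. K1 \<union> K2 = K}.
      (\<exists>u. v = Node u \<and> restr K1 (record_at G u) \<in> content_sem vt c1) \<and>
      (\<exists>u. v = Node u \<and> restr K2 (record_at G u) \<in> content_sem vt c2))"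
    using 3 by (intro definable_Bex definable_and) (auto intro: finite_subset)
  then show ?case
  proof (rule definable_cong)
    fix G :: "('n, 'p, 'k, 'v) cgraph" and v :: "('n, 'v) elem"
    assume "common_graph G"
    then show "(\<exists>u. v = Node u \<and> restr K (record_at G u) \<in> content_sem vt (CBoth c1 c2)) \<longleftrightarrow>
        (\<exists>K1 \<in> Pow K. \<exists>K2 \<in> {K2 \<in> Pow K. K1 \<union> K2 = K}.
          (\<exists>u. v = Node u \<and> restr K1 (record_at G u) \<in> content_sem vt c1) \<and>
          (\<exists>u. v = Node u \<and> restr K2 (record_at G u) \<in> content_sem vt c2))"
      by (cases v) (simp_all add: restr_CBoth[OF record_at_records] del: content_sem.simps)
  qed
next
  case (4 c1 c2)
  show ?case
    by (rule definable_cong[OF definable_or[OF "4.IH"(1)[OF "4.prems"] "4.IH"(2)[OF "4.prems"]]])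
       auto
qed

lemma definable_content_open:
  fixes vt :: "'t \<Rightarrow> 'v set" and c :: "('k, 't) content"
  assumes "UNIV \<in> range vt" and "closed_content c"
  shows "definable vt (\<lambda>(G :: ('n, 'p, 'k, 'v) cgraph) v.
    \<exists>u. v = Node u \<and> record_at G u \<in> content_sem vt (CBoth c CTop))"
proof -
  have "definable vt (\<lambda>(G :: ('n, 'p, 'k, 'v) cgraph) v. \<exists>K \<in> Pow (content_keys c).
      \<exists>u. v = Node u \<and> restr K (record_at G u) \<in> content_sem vt c)"
    using finite_content_keys
    by (intro definable_Bex definable_restr[OF assms]) (auto intro: finite_subset)
  then show ?thesis
  proof (rule definable_cong)
    fix G :: "('n, 'p, 'k, 'v) cgraph" and v :: "('n, 'v) elem"
    assume "common_graph G"
    then show "(\<exists>u. v = Node u \<and> record_at G u \<in> content_sem vt (CBoth c CTop)) \<longleftrightarrow>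
        (\<exists>K \<in> Pow (content_keys c).
           \<exists>u. v = Node u \<and> restr K (record_at G u) \<in> content_sem vt c)"
      by (simp only: content_open_iff[OF assms(2) record_at_records]) blast
  qed
qed

text \<open>A single closedness constraint does two jobs: its label set \<open>Q\<close> collects
  the keys of \<open>c\<close> and the predicates of \<open>P\<close>, so it bounds the keys of the
  record and also rules out edges labelled outside \<open>P\<close>.\<close>

lemma definable_closed_shape:
  fixes vt :: "'t \<Rightarrow> 'v set" and c :: "('k, 't) content"
  assumes "UNIV \<in> range vt" and "closed_content c"
  shows "definable vt
    (\<lambda>(G :: ('n, 'p, 'k, 'v) cgraph) v.
       common_sat vt G v (CAnd (CExists (PContent c)) (CNotExists (PNotPreds P))))"
proof -
  obtain Q where Q: "fset Q = Key ` content_keys c \<union> Pred ` fset P"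
    by (rule that[of "Abs_fset (Key ` content_keys c \<union> Pred ` fset P)"])
       (simp add: Abs_fset_inverse finite_content_keys)
  have "definable vt (\<lambda>G v. (\<exists>u. v = Node u \<and> restr (content_keys c) (record_at G u) \<in> content_sem vt c)
      \<and> \<not> (\<exists>q u. q |\<notin>| Q \<and> (v, q, u) \<in> triples G))"
    by (intro definable_and definable_closed definable_restr[OF assms] finite_content_keys)
  then show ?thesis
  proof (rule definable_cong)
    fix G :: "('n, 'p, 'k, 'v) cgraph" and v :: "('n, 'v) elem"
    assume G: "common_graph G" and v: "occurs G v"
    have content: "common_sat vt G v (CExists (PContent c)) \<longleftrightarrow>
        (\<exists>u. v = Node u \<and> record_at G u \<in> content_sem vt c)"
    proof -
      \<comment> \<open>The path requires a node of \<open>Nodes G\<close>; this is supplied by the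
        assumption that \<open>v\<close> occurs.\<close>
      have "{x. (v, x) \<in> cpath_sem vt G (PContent c)} =
          (if \<exists>u. v = Node u \<and> record_at G u \<in> content_sem vt c then {v} else {})"
        using v by (auto simp: occurs_def)
      then show ?thesis
        by (simp add: at_least_def)
    qed
    have preds: "common_sat vt G v (CNotExists (PNotPreds P)) \<longleftrightarrow>
        \<not> (\<exists>p u. p |\<notin>| P \<and> (v, Pred p, u) \<in> triples G)"
    proof -
      have "{x. (v, x) \<in> cpath_sem vt G (PNotPreds P)} =
          (\<lambda>(_, _, u). u) ` {t \<in> triples G. \<exists>p u. p |\<notin>| P \<and> t = (v, Pred p, u)}"
        by (force simp: triples_def image_iff)
      moreover have "finite \<dots>"
        using finite_triples[OF G] by simp
      ultimately show ?thesis
        by (auto simp: at_most_def)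
    qed
    have labels: "\<not> (\<exists>q u. q |\<notin>| Q \<and> (Node n, q, u) \<in> triples G) \<longleftrightarrow>
        Domain (record_at G n) \<subseteq> content_keys c \<and>
        \<not> (\<exists>p u. p |\<notin>| P \<and> (Node n, Pred p, u) \<in> triples G)" for n
    proof -
      have outside: "q |\<notin>| Q \<longleftrightarrow>
          (\<exists>k. q = Key k \<and> k \<notin> content_keys c) \<or> (\<exists>p. q = Pred p \<and> p |\<notin>| P)" for q
        by (cases q) (auto simp: Q)
      have "(\<exists>q u. q |\<notin>| Q \<and> (Node n, q, u) \<in> triples G) \<longleftrightarrow>
          (\<exists>k u. k \<notin> content_keys c \<and> (Node n, Key k, u) \<in> triples G) \<or>
          (\<exists>p u. p |\<notin>| P \<and> (Node n, Pred p, u) \<in> triples G)"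
        unfolding outside by blast
      also have "(\<exists>k u. k \<notin> content_keys c \<and> (Node n, Key k, u) \<in> triples G) \<longleftrightarrow>
          \<not> Domain (record_at G n) \<subseteq> content_keys c"
        unfolding Key_triple_iff by auto
      finally show ?thesis by blast
    qed
    show "common_sat vt G v (CAnd (CExists (PContent c)) (CNotExists (PNotPreds P))) \<longleftrightarrow>
        (\<exists>u. v = Node u \<and> restr (content_keys c) (record_at G u) \<in> content_sem vt c)
        \<and> \<not> (\<exists>q u. q |\<notin>| Q \<and> (v, q, u) \<in> triples G)"
    proof (cases v)
      case (Node n)
      have "common_sat vt G v (CExists (PContent c)) \<longleftrightarrow> record_at G n \<in> content_sem vt c"
        unfolding content by (simp add: Node)
      moreover have "(\<exists>u. v = Node u \<and> restr (content_keys c) (record_at G u) \<in> content_sem vt c)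
          \<longleftrightarrow> restr (content_keys c) (record_at G n) \<in> content_sem vt c"
        unfolding Node by simp
      moreover note preds labels[of n, folded Node]
        content_sem_iff[OF assms(2), of "record_at G n" vt]
      ultimately show ?thesis
        by (simp only: common_sat.simps(3) conj_ac)
    next
      case (Val w)
      then show ?thesis
        unfolding common_sat.simps(3) content by simp
    qed
  qed
qed


section \<open>Paths and shapes\<close>

lemma cpath_sem_PPred: "cpath_sem vt G (PPred p) = {(v, u). (v, Pred p, u) \<in> triples G}"
  by (auto simp: triples_def)

lemma cpath_sem_PKey: "cpath_sem vt G (PKey k) = {(v, u). (v, Key k, u) \<in> triples G}"
  by (auto simp: triples_def)

lemma pi0_subset_Id: "pi0 \<pi> \<Longrightarrow> cpath_sem vt G \<pi> \<subseteq> Id"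
  by (induction rule: pi0.induct) auto

text \<open>Filters lie in the identity relation, so the diagonal determines them and composition
  becomes conjunction.\<close>

lemma definable_pi0:
  assumes "UNIV \<in> range vt" and "pi0 \<pi>"
  shows "definable vt (\<lambda>G v. (v, v) \<in> cpath_sem vt G \<pi>)"
  using assms(2)
proof (induction rule: pi0.induct)
  case (1 k c)
  show ?case
    by (rule definable_cong[OF definable_ex_successor[OF definable_value[of _ c], where q = "Key k"]])
       (auto simp: Key_triple_iff occurs_def)
next
  case (2 k c)
  show ?case
    \<comment> \<open>A negated filter still fails at values, hence the conjunct that
      \<open>v\<close> is a node.\<close>
    by (rule definable_cong[OF definable_and[OF definable_node[OF assms(1)]
            definable_not[OF definable_ex_successor[OF definable_value[of _ c], where q = "Key k"]]]])
       (auto simp: Key_triple_iff occurs_def)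
next
  case (3 c)
  show ?case
    by (rule definable_cong[OF definable_content_open[OF assms(1) 3]])
       (auto simp: occurs_def simp del: content_sem.simps)
next
  case (4 c)
  show ?case
    by (rule definable_cong[OF definable_and[OF definable_node[OF assms(1)]
            definable_not[OF definable_content_open[OF assms(1) 4]]]])
       (auto simp: occurs_def simp del: content_sem.simps)
next
  case (5 \<pi> \<pi>')
  show ?case
    by (rule definable_cong[OF definable_and[OF 5(3,4)]])
       (use pi0_subset_Id[OF 5(1)] in auto)
qed

text \<open>\<open>Q\<close> is a continuation: the property required of the far end of the path.
  Composition feeds the property obtained from one factor to the other factor, so \<open>Q\<close>
  must be arbitrary. Both directions are proved together because converse exchanges them.\<close>

lemma definable_pibar:
  assumes "UNIV \<in> range vt" and "pibar \<pi>" and "definable vt Q"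
  shows "definable vt (\<lambda>G v. \<exists>u. (v, u) \<in> cpath_sem vt G \<pi> \<and> Q G u)"
    and "definable vt (\<lambda>G v. \<exists>u. (u, v) \<in> cpath_sem vt G \<pi> \<and> Q G u)"
  using assms(2,3)
proof (induction arbitrary: Q rule: pibar.induct)
  case (1 \<pi>)
  {
    case 1
    show ?case
      by (rule definable_cong[OF definable_and[OF definable_pi0[OF assms(1) \<open>pi0 \<pi>\<close>] 1]])
         (use pi0_subset_Id[OF \<open>pi0 \<pi>\<close>] in blast)
  next
    case 2
    show ?case
      by (rule definable_cong[OF definable_and[OF definable_pi0[OF assms(1) \<open>pi0 \<pi>\<close>] 2]])
         (use pi0_subset_Id[OF \<open>pi0 \<pi>\<close>] in blast)
  }
next
  case (2 p)
  {
    case 1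
    show ?case
      using definable_ex_successor[OF 1] by (simp add: cpath_sem_PPred del: cpath_sem.simps)
  next
    case 2
    show ?case
      using definable_ex_predecessor[OF 2] by (simp add: cpath_sem_PPred del: cpath_sem.simps)
  }
next
  case (3 \<pi>)
  {
    case 1
    show ?case using 3(3)[OF 1] by simp
  next
    case 2
    show ?case using 3(2)[OF 2] by simp
  }
next
  case (4 \<pi> \<pi>')
  {
    case 1
    show ?case
      by (rule definable_cong[OF 4(3)[OF 4(5)[OF 1]]]) auto
  next
    case 2
    show ?case
      \<comment> \<open>Traversed backwards, the factors swap roles: \<open>\<pi>'\<close> is now
        the outer step and \<open>\<pi>\<close> the inner one.\<close>
      by (rule definable_cong[OF 4(6)[OF 4(4)[OF 2]]]) auto
  }
next
  case (5 \<pi> \<pi>')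
  {
    case 1
    show ?case
      by (rule definable_cong[OF definable_or[OF 5(3)[OF 1] 5(5)[OF 1]]]) auto
  next
    case 2
    show ?case
      by (rule definable_cong[OF definable_or[OF 5(4)[OF 2] 5(6)[OF 2]]]) auto
  }
qed

lemma definable_cpath_pi:
  assumes "UNIV \<in> range vt" and "cpath_pi \<pi>"
  shows "definable vt (\<lambda>G v. \<exists>u. (v, u) \<in> cpath_sem vt G \<pi>)"
  using assms(2)
proof cases
  case 1
  show ?thesis
    using definable_pibar(1)[OF assms(1) 1 definable_True] by simp
next
  case (2 \<pi>' k)
  have "definable vt
      (\<lambda>G v. \<exists>u. (v, u) \<in> cpath_sem vt G \<pi>' \<and> (\<exists>x. (u, Key k, x) \<in> triples G \<and> True))"
    by (intro definable_pibar[OF assms(1) 2(2)] definable_ex_successor definable_True)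
  then show ?thesis
    by (rule definable_cong) (auto simp: 2(1) cpath_sem_PKey simp del: cpath_sem.simps(5))
next
  case (3 \<pi>' k)
  have "definable vt
      (\<lambda>G v. \<exists>u. (u, Key k, v) \<in> triples G \<and> (\<exists>x. (u, x) \<in> cpath_sem vt G \<pi>' \<and> True))"
    by (intro definable_pibar[OF assms(1) 3(2)] definable_ex_predecessor definable_True)
  then show ?thesis
    by (rule definable_cong) (auto simp: 3(1) cpath_sem_PKey simp del: cpath_sem.simps(5))
next
  case (4 \<pi>' k k')
  have "definable vt (\<lambda>G v. \<exists>u. (u, Key k, v) \<in> triples G \<and>
      (\<exists>x. (u, x) \<in> cpath_sem vt G \<pi>' \<and> (\<exists>y. (x, Key k', y) \<in> triples G \<and> True)))"
    by (intro definable_pibar[OF assms(1) 4(2)] definable_ex_predecessor definable_ex_successor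
        definable_True)
  then show ?thesis
    by (rule definable_cong) (auto simp: 4(1) cpath_sem_PKey simp del: cpath_sem.simps(5))
qed

section \<open>Finiteness of paths and counting along them\<close>

lemma finite_Nodes:
  assumes "common_graph G"
  shows "finite (Nodes G)"
proof -
  have "Nodes G \<subseteq> fst ` edges G \<union> (\<lambda>(_, _, u). u) ` edges G \<union> fst ` dom (props G)"
    (is "_ \<subseteq> ?A")
  proof
    fix u assume "u \<in> Nodes G"
    then consider p v where "(u, p, v) \<in> edges G" | p v where "(v, p, u) \<in> edges G"
      | k where "(u, k) \<in> dom (props G)"
      unfolding Nodes_def by blast
    then show "u \<in> ?A"
      by cases (auto intro: rev_image_eqI)
  qed
  moreover have "finite ?A"
    using assms by (simp add: common_graph_def)
  ultimately show ?thesis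
    by (rule finite_subset)
qed

text \<open>Even negated filters range over \<open>Nodes G\<close> only, so every atomic path is
  finite, and the path operators preserve finiteness.\<close>

lemma finite_cpath_sem:
  assumes "common_graph G"
  shows "finite (cpath_sem vt G \<pi>)"
proof -
  have node_filter: "finite {(Node u, Node u) | u. u \<in> Nodes G \<and> P u}" for P
    by (rule finite_subset[of _ "(\<lambda>u. (Node u, Node u)) ` Nodes G"])
       (auto simp: finite_Nodes[OF assms])
  have step: "finite {(v, u) | v u. \<exists>q. P q \<and> (v, q, u) \<in> triples G}" for P
    by (rule finite_subset[of _ "(\<lambda>(v, q, u). (v, u)) ` triples G"])
       (auto simp: finite_triples[OF assms] intro: rev_image_eqI)
  show ?thesis
  proof (induction \<pi>)
    case (PKey k)
    show ?case
      by (rule finite_subset[OF _ step[of "\<lambda>q. q = Key k"]]) (auto simp: triples_def)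
  next
    case (PPred p)
    show ?case
      by (rule finite_subset[OF _ step[of "\<lambda>q. q = Pred p"]]) (auto simp: triples_def)
  next
    case (PNotPreds P)
    show ?case
      by (rule finite_subset[OF _ step[of "\<lambda>_. True"]]) (auto simp: triples_def)
  qed (simp_all add: node_filter del: content_sem.simps)
qed

lemma finite_cpath_successors:
  assumes "common_graph G"
  shows "finite {u. (v, u) \<in> cpath_sem vt G \<pi>}"
  by (rule finite_subset[of _ "snd ` cpath_sem vt G \<pi>"])
     (auto intro: rev_image_eqI finite_cpath_sem[OF assms])

text \<open>The case \<open>n = 0\<close> is the exception: the count then holds even where the
  guard \<open>F\<close> fails.\<close>

lemma at_least_if:
  "at_least n {u. F \<and> P u} \<longleftrightarrow> n = 0 \<or> F \<and> at_least n {u. P u}"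
  by (cases F) (auto simp: at_least_def)

lemma definable_guarded:
  assumes "definable vt F"
    and "definable vt (\<lambda>G v. at_least n {u. P G v u})"
  shows "definable vt (\<lambda>G v. at_least n {u. F G v \<and> P G v u})"
  unfolding at_least_if
  by (cases "n = 0") (simp_all add: definable_True definable_and[OF assms])

text \<open>Such a path makes one step between filters, so its endpoints are counted directly among
  the neighbours: a filter before the step becomes a guard on \<open>v\<close>, one after it a
  condition on the neighbour.\<close>

lemma definable_pi1:
  assumes "UNIV \<in> range vt" and "pi1 \<pi>"
  shows "definable vt (\<lambda>G v. at_least n {u. (v, u) \<in> cpath_sem vt G \<pi>})"
  using assms(2)
proof cases
  case (1 \<pi>0 \<pi>0' p)
  have eq: "{u. (v, u) \<in> cpath_sem vt G \<pi>} = {u. (v, v) \<in> cpath_sem vt G \<pi>0 \<and>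
      (v, Pred p, u) \<in> triples G \<and> (u, u) \<in> cpath_sem vt G \<pi>0'}" for G v
    using pi0_subset_Id[OF 1(2), of vt G] pi0_subset_Id[OF 1(3), of vt G]
    unfolding 1(1) cpath_sem.simps(9) cpath_sem_PPred by blast
  show ?thesis
    unfolding eq
    by (intro definable_guarded definable_successors definable_pi0[OF assms(1)] 1(2,3))
next
  case (2 \<pi>0 \<pi>0' p)
  have eq: "{u. (v, u) \<in> cpath_sem vt G \<pi>} = {u. (v, v) \<in> cpath_sem vt G \<pi>0 \<and>
      (u, Pred p, v) \<in> triples G \<and> (u, u) \<in> cpath_sem vt G \<pi>0'}" for G v
    using pi0_subset_Id[OF 2(2), of vt G] pi0_subset_Id[OF 2(3), of vt G]
    unfolding 2(1) cpath_sem.simps(8,9) cpath_sem_PPred by blast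
  show ?thesis
    unfolding eq
    by (intro definable_guarded definable_predecessors definable_pi0[OF assms(1)] 2(2,3))
next
  case (3 \<pi>0 k)
  have eq: "{u. (v, u) \<in> cpath_sem vt G \<pi>} = {u. (v, v) \<in> cpath_sem vt G \<pi>0 \<and>
      (v, Key k, u) \<in> triples G \<and> True}" for G v
    using pi0_subset_Id[OF 3(2), of vt G]
    unfolding 3(1) cpath_sem.simps(9) cpath_sem_PKey by blast
  show ?thesis
    unfolding eq
    by (intro definable_guarded definable_successors definable_True definable_pi0[OF assms(1)] 3(2))
next
  case (4 \<pi>0 k)
  have eq: "{u. (v, u) \<in> cpath_sem vt G \<pi>} = {u. (u, Key k, v) \<in> triples G \<and>
      (u, u) \<in> cpath_sem vt G \<pi>0}" for G v
    using pi0_subset_Id[OF 4(2), of vt G]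
    unfolding 4(1) cpath_sem.simps(8,9) cpath_sem_PKey by blast
  show ?thesis
    unfolding eq by (intro definable_predecessors definable_pi0[OF assms(1)] 4(2))
qed

lemma at_most_iff: "at_most n A \<longleftrightarrow> \<not> at_least (Suc n) A"
  unfolding at_most_def at_least_def by auto

lemma definable_common_shape:
  assumes "UNIV \<in> range vt" and "common_shape \<phi>"
  shows "definable vt (\<lambda>G v. common_sat vt G v \<phi>)"
  using assms(2)
proof (induction rule: common_shape.induct)
  case (1 \<pi>)
  show ?case
    by (rule definable_cong[OF definable_cpath_pi[OF assms(1) 1]])
       (simp add: at_least_1 finite_cpath_successors del: One_nat_def)
next
  case (2 \<pi> n)
  show ?case
    using definable_not[OF definable_pi1[OF assms(1) 2]] by (simp add: at_most_iff)
next
  case (3 \<pi> n)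
  show ?case
    using definable_pi1[OF assms(1) 3] by simp
next
  case (4 c P)
  show ?case
    by (rule definable_closed_shape[OF assms(1) 4])
next
  case (5 \<phi> \<psi>)
  show ?case
    using definable_and[OF 5(3,4)] by simp
qed


section \<open>Selectors\<close>

text \<open>The label and the direction are read off the head, before \<open>G\<close> and
  \<open>v\<close> are given. A positive filter on \<open>k\<close> forces an outgoing triple
  labelled \<open>Key k\<close>.\<close>

lemma selector_head_step:
  fixes vt :: "'t \<Rightarrow> 'v set" and h :: "('p, 'k, 'v, 't) cpath"
    and Q :: "('n, 'p, 'k, 'v) cgraph \<Rightarrow> ('n, 'v) elem \<Rightarrow> bool"
  assumes "selector_head h" and "\<And>G v. Q G v \<Longrightarrow> \<exists>u. (v, u) \<in> cpath_sem vt G h"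
  shows "\<exists>q. (\<forall>G v. Q G v \<longrightarrow> (\<exists>x. (v, q, x) \<in> triples G)) \<or>
    (\<forall>G v. Q G v \<longrightarrow> (\<exists>x. (x, q, v) \<in> triples G))"
  using assms(1)
proof cases
  case (1 p)
  have "\<exists>x. (v, Pred p, x) \<in> triples G" if "Q G v" for G v
    using assms(2)[OF that] unfolding 1 by (auto simp: triples_def)
  then show ?thesis
    by (intro exI[of _ "Pred p"] disjI1 allI impI)
next
  case (2 p)
  have "\<exists>x. (x, Pred p, v) \<in> triples G" if "Q G v" for G v
    using assms(2)[OF that] unfolding 2 by (auto simp: triples_def)
  then show ?thesis
    by (intro exI[of _ "Pred p"] disjI2 allI impI)
next
  case (3 k c)
  have "\<exists>x. (v, Key k, x) \<in> triples G" if "Q G v" for G v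
    using assms(2)[OF that] unfolding 3 by (auto simp: Key_triple_iff)
  then show ?thesis
    by (intro exI[of _ "Key k"] disjI1 allI impI)
next
  case (4 k t)
  have "\<exists>x. (v, Key k, x) \<in> triples G" if "Q G v" for G v
    using assms(2)[OF that] unfolding 4 by (auto simp: Key_triple_iff)
  then show ?thesis
    by (intro exI[of _ "Key k"] disjI1 allI impI)
next
  case (5 k)
  have "\<exists>x. (x, Key k, v) \<in> triples G" if "Q G v" for G v
    using assms(2)[OF that] unfolding 5 by (auto simp: triples_def)
  then show ?thesis
    by (intro exI[of _ "Key k"] disjI2 allI impI)
qed

lemma common_sat_CExists:
  assumes "common_graph G"
  shows "common_sat vt G v (CExists \<pi>) \<longleftrightarrow> (\<exists>u. (v, u) \<in> cpath_sem vt G \<pi>)"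
  using at_least_1[OF finite_cpath_successors[OF assms]] by simp

lemma common_selector_step:
  fixes vt :: "'t \<Rightarrow> 'v set" and sel :: "('p, 'k, 'v, 't) cshape"
  assumes "common_selector sel"
  shows "\<exists>q. (\<forall>(G :: ('n, 'p, 'k, 'v) cgraph) v.
       common_graph G \<longrightarrow> common_sat vt G v sel \<longrightarrow> (\<exists>x. (v, q, x) \<in> triples G)) \<or>
    (\<forall>(G :: ('n, 'p, 'k, 'v) cgraph) v.
       common_graph G \<longrightarrow> common_sat vt G v sel \<longrightarrow> (\<exists>x. (x, q, v) \<in> triples G))"
  using assms
proof cases
  case (1 k)
  have "\<exists>x. (v, Key k, x) \<in> triples G"
    if "common_graph G" "common_sat vt G v sel" for G :: "('n, 'p, 'k, 'v) cgraph" and v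
    using that(2) unfolding 1 common_sat_CExists[OF that(1)] by (auto simp: triples_def)
  then show ?thesis
    by (intro exI[of _ "Key k"] disjI1 allI impI)
next
  case (2 h \<pi>)
  have "\<exists>u. (v, u) \<in> cpath_sem vt G h"
    if "common_graph G \<and> common_sat vt G v sel" for G :: "('n, 'p, 'k, 'v) cgraph" and v
    using that unfolding 2(1) by (auto simp: common_sat_CExists simp del: common_sat.simps One_nat_def)
  from selector_head_step[where Q = "\<lambda>G v. common_graph G \<and> common_sat vt G v sel",
      OF 2(2) this] show ?thesis
    by (simp only: HOL.imp_conjL)
next
  case (3 h \<pi> k)
  have "\<exists>u. (v, u) \<in> cpath_sem vt G h"
    if "common_graph G \<and> common_sat vt G v sel" for G :: "('n, 'p, 'k, 'v) cgraph" and v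
    using that unfolding 3(1) by (auto simp: common_sat_CExists simp del: common_sat.simps One_nat_def)
  from selector_head_step[where Q = "\<lambda>G v. common_graph G \<and> common_sat vt G v sel",
      OF 3(2) this] show ?thesis
    by (simp only: HOL.imp_conjL)
qed

lemma shacl_selector_steps:
  assumes "common_graph G"
  shows "shacl_sat vt G v (SAtLeast 1 (SStep q) STop) \<longleftrightarrow> (\<exists>x. (v, q, x) \<in> triples G)"
    and "shacl_sat vt G v (SAtLeast 1 (SConv (SStep q)) STop) \<longleftrightarrow> (\<exists>x. (x, q, v) \<in> triples G)"
  using at_least_1[OF finite_successors[OF assms, of v q "\<lambda>_. True"]]
    at_least_1[OF finite_predecessors[OF assms, of q v "\<lambda>_. True"]] by simp_all

lemma shex_selector_steps:
  assumes "common_graph G"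
  shows "shex_sat vt G (XOpen (XDir q XTop)) v \<longleftrightarrow> (\<exists>x. (v, q, x) \<in> triples G)"
    and "shex_sat vt G (XOpen (XInv q XTop)) v \<longleftrightarrow> (\<exists>x. (x, q, v) \<in> triples G)"
proof -
  have "shex_sat vt G (XOpen (XDir q XTop)) v \<longleftrightarrow>
      (\<exists>x. (v, Dir q, x) \<in> all_dir \<and> (v, Dir q, x) \<in> neigh G v)"
    unfolding shex_sat_open[OF assms] xexpr_sem.simps using shex_sat_top[OF assms] by auto
  then show "shex_sat vt G (XOpen (XDir q XTop)) v \<longleftrightarrow> (\<exists>x. (v, q, x) \<in> triples G)"
    using triples_subset_all[of G] unfolding neigh_def all_dir_def by blast
  have "shex_sat vt G (XOpen (XInv q XTop)) v \<longleftrightarrow>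
      (\<exists>x. (v, Inv q, x) \<in> all_inv \<and> (v, Inv q, x) \<in> neigh G v)"
    unfolding shex_sat_open[OF assms] xexpr_sem.simps using shex_sat_top[OF assms] by auto
  then show "shex_sat vt G (XOpen (XInv q XTop)) v \<longleftrightarrow> (\<exists>x. (x, q, v) \<in> triples G)"
    using triples_Inv[of _ q v G] unfolding neigh_def by blast
qed

text \<open>\<open>B\<close> stands for having a triple with the chosen label in the chosen
  direction. Both languages have a selector for exactly this, and it makes the element
  occur.\<close>

lemma common_selector_relaxation:
  fixes sel :: "('p, 'k, 'v, 't) cshape" and vt :: "'t \<Rightarrow> 'v set"
  assumes "common_selector sel"
  obtains s1 :: "('p, 'k, 'v, 't) sshape" and s2 :: "('p, 'k, 'v, 't) xshape"
    and B :: "('n, 'p, 'k, 'v) cgraph \<Rightarrow> ('n, 'v) elem \<Rightarrow> bool"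
  where "shacl_selector s1" and "shex_selector s2"
    and "\<And>G v. common_graph G \<Longrightarrow> shacl_sat vt G v s1 \<longleftrightarrow> B G v"
    and "\<And>G v. common_graph G \<Longrightarrow> shex_sat vt G s2 v \<longleftrightarrow> B G v"
    and "\<And>G v. common_graph G \<Longrightarrow> common_sat vt G v sel \<Longrightarrow> B G v"
    and "\<And>G v. B G v \<Longrightarrow> occurs G v"
proof -
  from common_selector_step[OF assms, of vt] obtain q
    where "(\<forall>(G :: ('n, 'p, 'k, 'v) cgraph) v. common_graph G \<longrightarrow> common_sat vt G v sel \<longrightarrow>
        (\<exists>x. (v, q, x) \<in> triples G)) \<or>
      (\<forall>(G :: ('n, 'p, 'k, 'v) cgraph) v. common_graph G \<longrightarrow> common_sat vt G v sel \<longrightarrow>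
        (\<exists>x. (x, q, v) \<in> triples G))"
    by blast
  then show thesis
  proof
    assume *: "\<forall>(G :: ('n, 'p, 'k, 'v) cgraph) v. common_graph G \<longrightarrow> common_sat vt G v sel \<longrightarrow>
        (\<exists>x. (v, q, x) \<in> triples G)"
    show thesis
      by (rule that[OF shacl_selector.intros(1) shex_selector.intros(3)
            shacl_selector_steps(1) shex_selector_steps(1)])
         (use * triples_occurs(1) in blast)+
  next
    assume *: "\<forall>(G :: ('n, 'p, 'k, 'v) cgraph) v. common_graph G \<longrightarrow> common_sat vt G v sel \<longrightarrow>
        (\<exists>x. (x, q, v) \<in> triples G)"
    show thesis
      by (rule that[OF shacl_selector.intros(2) shex_selector.intros(4)
            shacl_selector_steps(2) shex_selector_steps(2)])
         (use * triples_occurs(2) in blast)+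
  qed
qed

section \<open>Translating constraints and schemas\<close>

lemma schema_sat_singleton: "schema_sat sat {(sel, \<phi>)} \<longleftrightarrow> (\<forall>v. sat v sel \<longrightarrow> sat v \<phi>)"
  unfolding schema_sat_def by simp

text \<open>The new shape expresses that \<open>sel\<close> implies \<open>\<phi>\<close>; this is
  definable because selectors are themselves shapes. Where \<open>B\<close> fails, both constraints
  hold vacuously. Where \<open>B\<close> holds, the element occurs, so the new shape is correct
  there.\<close>

lemma constraint_translation:
  fixes sel \<phi> :: "('p, 'k, 'v, 't) cshape" and vt :: "'t \<Rightarrow> 'v set"
  assumes "UNIV \<in> range vt" and "common_selector sel" and "common_shape \<phi>"
  shows "\<exists>(c1 :: ('p, 'k, 'v, 't) sshape \<times> ('p, 'k, 'v, 't) sshape)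
      (c2 :: ('p, 'k, 'v, 't) xshape \<times> ('p, 'k, 'v, 't) xshape).
    shacl_selector (fst c1) \<and> shex_selector (fst c2) \<and>
    (\<forall>G :: ('n, 'p, 'k, 'v) cgraph. common_graph G \<longrightarrow>
       (common_models vt G {(sel, \<phi>)} \<longleftrightarrow> shacl_models vt G {c1}) \<and>
       (common_models vt G {(sel, \<phi>)} \<longleftrightarrow> shex_models vt G {c2}))"
proof -
  obtain s1 :: "('p, 'k, 'v, 't) sshape" and s2 :: "('p, 'k, 'v, 't) xshape"
    and B :: "('n, 'p, 'k, 'v) cgraph \<Rightarrow> ('n, 'v) elem \<Rightarrow> bool"
    where s: "shacl_selector s1" "shex_selector s2"
      "\<And>G v. common_graph G \<Longrightarrow> shacl_sat vt G v s1 \<longleftrightarrow> B G v"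
      "\<And>G v. common_graph G \<Longrightarrow> shex_sat vt G s2 v \<longleftrightarrow> B G v"
      "\<And>G v. common_graph G \<Longrightarrow> common_sat vt G v sel \<Longrightarrow> B G v"
      "\<And>G v. B G v \<Longrightarrow> occurs G v"
    using common_selector_relaxation[OF assms(2), where vt = vt] by blast
  have "definable vt (\<lambda>(G :: ('n, 'p, 'k, 'v) cgraph) v.
      common_sat vt G v sel \<longrightarrow> common_sat vt G v \<phi>)"
    by (intro definable_imp definable_common_shape[OF assms(1)] assms(3)
        common_selector_imp_common_shape[OF assms(2)])
  then obtain \<phi>1 :: "('p, 'k, 'v, 't) sshape" and \<phi>2 :: "('p, 'k, 'v, 't) xshape"
    where "expresses vt \<phi>1 \<phi>2 (\<lambda>(G :: ('n, 'p, 'k, 'v) cgraph) v.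
      common_sat vt G v sel \<longrightarrow> common_sat vt G v \<phi>)"
    unfolding definable_def by blast
  note d = expressesD[OF this]
  show ?thesis
  proof (intro exI conjI allI impI)
    show "shacl_selector (fst (s1, \<phi>1))" "shex_selector (fst (s2, \<phi>2))"
      using s by simp_all
    fix G :: "('n, 'p, 'k, 'v) cgraph" assume G: "common_graph G"
    show "common_models vt G {(sel, \<phi>)} \<longleftrightarrow> shacl_models vt G {(s1, \<phi>1)}"
      unfolding common_models_def shacl_models_def schema_sat_singleton
    proof (rule arg_cong[where f = All], rule ext)
      fix v
      show "(common_sat vt G v sel \<longrightarrow> common_sat vt G v \<phi>) =
          (shacl_sat vt G v s1 \<longrightarrow> shacl_sat vt G v \<phi>1)"
        using s(3)[OF G, of v] s(5)[OF G, of v] s(6)[of G v] d(1)[OF G, of v]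
        by (cases "B G v") auto
    qed
    show "common_models vt G {(sel, \<phi>)} \<longleftrightarrow> shex_models vt G {(s2, \<phi>2)}"
      unfolding common_models_def shex_models_def schema_sat_singleton
    proof (rule arg_cong[where f = All], rule ext)
      fix v
      show "(common_sat vt G v sel \<longrightarrow> common_sat vt G v \<phi>) =
          (shex_sat vt G s2 v \<longrightarrow> shex_sat vt G \<phi>2 v)"
        using s(4)[OF G, of v] s(5)[OF G, of v] s(6)[of G v] d(2)[OF G, of v]
        by (cases "B G v") auto
    qed
  qed
qed

text \<open>Allows the pairs of a schema to be translated independently of one another.\<close>

lemma schema_sat_iff_singletons: "schema_sat sat S \<longleftrightarrow> (\<forall>c \<in> S. schema_sat sat {c})"
  unfolding schema_sat_def by blast

theorem proposition1:
  fixes vt :: "'t::countable \<Rightarrow> 'v::countable set"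
    and any_type :: 't
    and S :: "(('p::countable, 'k::countable, 'v, 't) cshape \<times> ('p, 'k, 'v, 't) cshape) set"
  assumes "\<forall>w. \<exists>t. w \<in> vt t"
    and "vt any_type = UNIV"
    and "common_schema S"
  shows "\<exists>(S1 :: (('p, 'k, 'v, 't) sshape \<times> ('p, 'k, 'v, 't) sshape) set)
          (S2 :: (('p, 'k, 'v, 't) xshape \<times> ('p, 'k, 'v, 't) xshape) set).
           shacl_schema S1 \<and> shex_schema S2 \<and>
           (\<forall>G :: ('n::countable, 'p, 'k, 'v) cgraph. common_graph G \<longrightarrow>
              (common_models vt G S \<longleftrightarrow> shacl_models vt G S1) \<and>
              (common_models vt G S \<longleftrightarrow> shex_models vt G S2))"
proof -
  have any: "UNIV \<in> range vt"
    using assms(2) by (metis rangeI)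
  have "\<forall>c \<in> S. \<exists>(c1 :: ('p, 'k, 'v, 't) sshape \<times> ('p, 'k, 'v, 't) sshape)
      (c2 :: ('p, 'k, 'v, 't) xshape \<times> ('p, 'k, 'v, 't) xshape).
      shacl_selector (fst c1) \<and> shex_selector (fst c2) \<and>
      (\<forall>G :: ('n, 'p, 'k, 'v) cgraph. common_graph G \<longrightarrow>
         (common_models vt G {c} \<longleftrightarrow> shacl_models vt G {c1}) \<and>
         (common_models vt G {c} \<longleftrightarrow> shex_models vt G {c2}))"
    (is "\<forall>c \<in> S. ?P c")
  proof
    fix c assume "c \<in> S"
    then obtain sel \<phi> where "c = (sel, \<phi>)" "common_selector sel" "common_shape \<phi>"
      using assms(3) unfolding common_schema_def by (cases c) auto
    then show "?P c"
      using constraint_translation[OF any] by simp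
  qed
  \<comment> \<open>Choice fixes one translation per pair, independent of the graph; the image of
    the finite set \<open>S\<close> is then a finite SHACL schema.\<close>
  then obtain f1 :: "_ \<Rightarrow> ('p, 'k, 'v, 't) sshape \<times> ('p, 'k, 'v, 't) sshape" where
    "\<forall>c \<in> S. \<exists>(c2 :: ('p, 'k, 'v, 't) xshape \<times> ('p, 'k, 'v, 't) xshape).
      shacl_selector (fst (f1 c)) \<and> shex_selector (fst c2) \<and>
      (\<forall>G :: ('n, 'p, 'k, 'v) cgraph. common_graph G \<longrightarrow>
         (common_models vt G {c} \<longleftrightarrow> shacl_models vt G {f1 c}) \<and>
         (common_models vt G {c} \<longleftrightarrow> shex_models vt G {c2}))"
    by (rule bchoice[THEN exE])
  then obtain f2 :: "_ \<Rightarrow> ('p, 'k, 'v, 't) xshape \<times> ('p, 'k, 'v, 't) xshape" where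
    "\<forall>c \<in> S. shacl_selector (fst (f1 c)) \<and> shex_selector (fst (f2 c)) \<and>
      (\<forall>G :: ('n, 'p, 'k, 'v) cgraph. common_graph G \<longrightarrow>
         (common_models vt G {c} \<longleftrightarrow> shacl_models vt G {f1 c}) \<and>
         (common_models vt G {c} \<longleftrightarrow> shex_models vt G {f2 c}))"
    by (rule bchoice[THEN exE])
  note f12 = bspec[OF this]
  note f = f12[THEN conjunct1] f12[THEN conjunct2, THEN conjunct1]
    f12[THEN conjunct2, THEN conjunct2, THEN spec, THEN mp, THEN conjunct1]
    f12[THEN conjunct2, THEN conjunct2, THEN spec, THEN mp, THEN conjunct2]
  show ?thesis
  proof (intro exI conjI allI impI)
    show "shacl_schema (f1 ` S)"
      using f(1) assms(3) by (force simp: shacl_schema_def common_schema_def)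
    show "shex_schema (f2 ` S)"
      using f(2) by (force simp: shex_schema_def)
    fix G :: "('n, 'p, 'k, 'v) cgraph" assume G: "common_graph G"
    note single = schema_sat_iff_singletons[of _ S] schema_sat_iff_singletons[of _ "f1 ` S"]
      schema_sat_iff_singletons[of _ "f2 ` S"]
    show "common_models vt G S \<longleftrightarrow> shacl_models vt G (f1 ` S)"
      using f(3)[OF _ G] unfolding common_models_def shacl_models_def single by simp
    show "common_models vt G S \<longleftrightarrow> shex_models vt G (f2 ` S)"
      using f(4)[OF _ G] unfolding common_models_def shex_models_def single by simp
  qed
qed

end
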